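(* Let $J_0$ be a real symmetric $2$-periodic Jacobi matrix with continuous spectrum $[-d,-s]\cup[s,d]$, $0<s<d$, and $|\nu|<s$, where $\nu=b_1^0$. With $\varepsilon$, $w$, $\psi_n$ as in the context and $\chi_1(\lambda)=w^{-1}(\lambda)\psi_1(\lambda)$, one has $$\chi_1(\lambda)=\frac{4a_1^0\,(\lambda+\nu)\,w(\lambda)}{d^2-s^2}\cdot\frac{1}{w^2(\lambda)-w^{2\varepsilon}(\nu)}$$ for all $\lambda\in\mathbb{C}\setminus\big([-d,-s]\cup[s,d]\big)$, with $\lambda\ne\nu$ if $\varepsilon=1$, where at a point in this set at which the denominator vanishes (this can only be $\lambda=-\nu$ with $\varepsilon=1$) the right-hand side is understood as its limit.
   Context: $J_0$ acts on $\ell^2(\mathbb{N})$ by $(J_0y)_n=a^0_{n-1}y_{n-1}+b^0_ny_n+a^0_ny_{n+1}$ (with $y_0=0$), with $a^0_{n+2}=a^0_n>0$, $b^0_{n+2}=b^0_n\in\mathbb{R}$, $a_0^0:=a_2^0$. Its continuous spectrum is $\sigma_c(J_0)=[-d,-s]\cup[s,d]$ with $0<s<d$. Let $s_n(\lambda)$, $c_n(\lambda)$ be the solutions of $a^0_{n-1}y_{n-1}+b^0_ny_n+a^0_ny_{n+1}=\lambda y_n$, $n\ge1$, with $s_0=0,\ s_1=1$ and $c_0=1,\ c_1=0$. Put $u=\frac12(s_3+c_2)$ and $v=\frac12(s_3-c_2)$; then $u(\lambda)=\frac{2}{d^2-s^2}\left(\lambda^2-\frac{d^2+s^2}{2}\right)$.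 The root of $s_2$ is $\nu=b_1^0$, and it is assumed that $|\nu|<s$. For $\lambda\notin\sigma_c(J_0)$ let $w^2(\lambda)$ be the unique root $\zeta$, $|\zeta|<1$, of $\zeta+\zeta^{-1}=2u(\lambda)$, and set $(u^2(\lambda)-1)^{1/2}:=u(\lambda)-w^2(\lambda)$. The function $w(\lambda)$ is the square root of $w^2(\lambda)$ that is analytic in $\mathbb{C}\setminus[-d,d]$ and positive for $\lambda>d$; on $(-s,s)$ either of the boundary values $w(\lambda\pm i0)$ may be used (the same one on both sides of the identity). Also $w^{2\varepsilon}(\nu)=(w^2(\nu))^{\varepsilon}$. The Weyl function is $m(\lambda)=\dfrac{v(\lambda)-(u^2(\lambda)-1)^{1/2}}{s_2(\lambda)}$ and the Weyl (Floquet) solution is $\psi_n(\lambda)=c_n(\lambda)+m(\lambda)s_n(\lambda)$, so $\psi_0=1$, $\psi_1=m$. Put $\varepsilon=1$ if $m$ has a pole at $\nu$, and $\varepsilon=-1$ otherwise (removable singularity). *)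

theory Defs
  imports "HOL-Complex_Analysis.Complex_Analysis"
begin

(* The half-line space l^2 over {1,2,...}: sequences carry an extra entry at index 0
   that is required to vanish, which is the convention y_0 = 0 in the action of the
   Jacobi matrix. *)
definition ell2 :: "(nat \<Rightarrow> complex) set" where
  "ell2 = {y. y 0 = 0 \<and> summable (\<lambda>n. (cmod (y n))\<^sup>2)}"

definition ell2_norm :: "(nat \<Rightarrow> complex) \<Rightarrow> real" where
  "ell2_norm y = sqrt (\<Sum>n. (cmod (y n))\<^sup>2)"

definition jacobi_op ::
    "(nat \<Rightarrow> real) \<Rightarrow> (nat \<Rightarrow> real) \<Rightarrow> (nat \<Rightarrow> complex) \<Rightarrow> nat \<Rightarrow> complex" where
  "jacobi_op a b y n =
     (if n = 0 then 0
      else of_real (a (n - 1)) * y (n - 1) + of_real (b n) * y n + of_real (a n) * y (n + 1))"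

(* T is meant to be a bounded operator on ell2, so by the bounded inverse theorem
   failure of surjectivity of the injective, densely ranged T - z is the same as
   unboundedness of its inverse. *)
definition continuous_spectrum ::
    "((nat \<Rightarrow> complex) \<Rightarrow> nat \<Rightarrow> complex) \<Rightarrow> complex set" where
  "continuous_spectrum T =
     {z. inj_on (\<lambda>y n. T y n - z * y n) ell2 \<and>
         (\<forall>f\<in>ell2. \<forall>e>0. \<exists>y\<in>ell2. ell2_norm (\<lambda>n. f n - (T y n - z * y n)) < e) \<and>
         (\<lambda>y n. T y n - z * y n) ` ell2 \<noteq> ell2}"

(* The solution of the three-term recurrence
     a_(n-1) y_(n-1) + b_n y_n + a_n y_(n+1) = z y_n,  n >= 1,
   with prescribed values y_0 and y_1, solved for the last entry (a_n > 0). *)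
fun jacobi_sol ::
    "(nat \<Rightarrow> real) \<Rightarrow> (nat \<Rightarrow> real) \<Rightarrow> complex \<Rightarrow> complex \<Rightarrow> nat \<Rightarrow> complex \<Rightarrow> complex" where
  "jacobi_sol a b y0 y1 0 z = y0"
| "jacobi_sol a b y0 y1 (Suc 0) z = y1"
| "jacobi_sol a b y0 y1 (Suc (Suc n)) z =
     ((z - of_real (b (Suc n))) * jacobi_sol a b y0 y1 (Suc n) z
        - of_real (a n) * jacobi_sol a b y0 y1 n z) / of_real (a (Suc n))"

definition sin_sol :: "(nat \<Rightarrow> real) \<Rightarrow> (nat \<Rightarrow> real) \<Rightarrow> nat \<Rightarrow> complex \<Rightarrow> complex" where
  "sin_sol a b = jacobi_sol a b 0 1"

definition cos_sol :: "(nat \<Rightarrow> real) \<Rightarrow> (nat \<Rightarrow> real) \<Rightarrow> nat \<Rightarrow> complex \<Rightarrow> complex" where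
  "cos_sol a b = jacobi_sol a b 1 0"

definition u_fun :: "(nat \<Rightarrow> real) \<Rightarrow> (nat \<Rightarrow> real) \<Rightarrow> complex \<Rightarrow> complex" where
  "u_fun a b z = (sin_sol a b 3 z + cos_sol a b 2 z) / 2"

definition v_fun :: "(nat \<Rightarrow> real) \<Rightarrow> (nat \<Rightarrow> real) \<Rightarrow> complex \<Rightarrow> complex" where
  "v_fun a b z = (sin_sol a b 3 z - cos_sol a b 2 z) / 2"

(* The function w^2. The root exists and is unique off the continuous spectrum; the
   condition x \<noteq> 0 only excludes the convention inverse 0 = 0. *)
definition w2_fun :: "(nat \<Rightarrow> real) \<Rightarrow> (nat \<Rightarrow> real) \<Rightarrow> complex \<Rightarrow> complex" where
  "w2_fun a b z = (THE x. x \<noteq> 0 \<and> cmod x < 1 \<and> x + inverse x = 2 * u_fun a b z)"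

(* The branch of (u^2 - 1)^(1/2). *)
definition root_fun :: "(nat \<Rightarrow> real) \<Rightarrow> (nat \<Rightarrow> real) \<Rightarrow> complex \<Rightarrow> complex" where
  "root_fun a b z = u_fun a b z - w2_fun a b z"

(* remove_sings supplies the value of m at the zero of s_2 when the singularity there is
   removable, where the quotient itself would read x / 0 = 0; off the continuous spectrum
   it changes nothing at the other points. *)
definition weyl_m :: "(nat \<Rightarrow> real) \<Rightarrow> (nat \<Rightarrow> real) \<Rightarrow> complex \<Rightarrow> complex" where
  "weyl_m a b = remove_sings (\<lambda>z. (v_fun a b z - root_fun a b z) / sin_sol a b 2 z)"

definition weyl_sol :: "(nat \<Rightarrow> real) \<Rightarrow> (nat \<Rightarrow> real) \<Rightarrow> nat \<Rightarrow> complex \<Rightarrow> complex" where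
  "weyl_sol a b n z = cos_sol a b n z + weyl_m a b z * sin_sol a b n z"

definition eps :: "(nat \<Rightarrow> real) \<Rightarrow> (nat \<Rightarrow> real) \<Rightarrow> int" where
  "eps a b = (if is_pole (weyl_m a b) (of_real (b 1)) then 1 else - 1)"

(* w is the analytic square root of w^2 off [-d,d] that is positive to the right of d.
   On the gap (-s,s), where w jumps, its values are the boundary values from the upper
   half-plane (\<sigma> = 1) or from the lower half-plane (\<sigma> = -1). *)
definition is_w_branch ::
    "(nat \<Rightarrow> real) \<Rightarrow> (nat \<Rightarrow> real) \<Rightarrow> real \<Rightarrow> real \<Rightarrow> real \<Rightarrow> (complex \<Rightarrow> complex) \<Rightarrow> bool" where
  "is_w_branch a b s d \<sigma> w \<longleftrightarrow>
     w holomorphic_on (- (of_real ` {-d..d})) \<and>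
     (\<forall>z. z \<notin> of_real ` {-d..d} \<longrightarrow> (w z)\<^sup>2 = w2_fun a b z) \<and>
     (\<forall>x>d. w (of_real x) \<in> \<real> \<and> 0 < Re (w (of_real x))) \<and>
     (\<forall>x\<in>{-s<..<s}. (w \<longlongrightarrow> w (of_real x)) (at (of_real x) within {z. 0 < \<sigma> * Im z}))"

definition chi1 ::
    "(nat \<Rightarrow> real) \<Rightarrow> (nat \<Rightarrow> real) \<Rightarrow> (complex \<Rightarrow> complex) \<Rightarrow> complex \<Rightarrow> complex" where
  "chi1 a b w z = inverse (w z) * weyl_sol a b 1 z"

end

theory Submission
  imports Defs
begin

text \<open>
  The discriminant \<open>u\<close> is read off from the spectrum by elementary means. For \<open>\<bar>u(z)\<bar> > 1\<close> the monodromy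
  matrix is hyperbolic, so either \<open>J - z\<close> is onto or the sine solution is an eigenvector; in both
  cases \<open>z\<close> is outside the continuous spectrum. For real \<open>u(z)\<close> with \<open>\<bar>u(z)\<bar> < 1\<close> an invariant definite form
  keeps solutions bounded and excludes decay, which puts \<open>z\<close> into it. Comparing the two descriptions of
  the bands yields \<open>b\<^sub>2 = -b\<^sub>1\<close>, \<open>s\<^sup>2 = \<nu>\<^sup>2 + (a\<^sub>1 - a\<^sub>0)\<^sup>2\<close> and \<open>d\<^sup>2 = \<nu>\<^sup>2 + (a\<^sub>1 + a\<^sub>0)\<^sup>2\<close>.

  Then \<open>m = (a\<^sub>1 w\<^sup>2 + a\<^sub>0) / (z - \<nu>)\<close>, and the quadratic equation for \<open>w\<^sup>2\<close> reads
  \<open>(a\<^sub>1 w\<^sup>2 + a\<^sub>0)(a\<^sub>0 w\<^sup>2 + a\<^sub>1) = w\<^sup>2 (z\<^sup>2 - \<nu>\<^sup>2)\<close>. The function \<open>m\<close> has a pole at \<open>\<nu>\<close> exactly if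
  \<open>a\<^sub>1 < a\<^sub>0\<close>, and in either case \<open>w\<^bsup>2\<epsilon>\<^esup>(\<nu>) = -a\<^sub>1/a\<^sub>0\<close>.
\<close>

section \<open>Square-summable sequences and constant-coefficient recurrences\<close>

abbreviation square_summable :: "(nat \<Rightarrow> complex) \<Rightarrow> bool" where
  "square_summable x \<equiv> summable (\<lambda>n. (cmod (x n))\<^sup>2)"

lemma square_summable_add:
  assumes "square_summable x" "square_summable y"
  shows "square_summable (\<lambda>n. x n + y n)"
proof (rule summable_comparison_test')
  show "summable (\<lambda>n. 2 * (cmod (x n))\<^sup>2 + 2 * (cmod (y n))\<^sup>2)"
    using assms by (intro summable_add summable_mult)
  fix n
  have "(cmod (x n + y n))\<^sup>2 \<le> (cmod (x n) + cmod (y n))\<^sup>2"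
    by (intro power_mono norm_triangle_ineq norm_ge_zero)
  also have "\<dots> \<le> 2 * (cmod (x n))\<^sup>2 + 2 * (cmod (y n))\<^sup>2"
    using sum_squares_bound[of "cmod (x n)" "cmod (y n)"] by (simp add: power2_sum)
  finally show "norm ((cmod (x n + y n))\<^sup>2) \<le> 2 * (cmod (x n))\<^sup>2 + 2 * (cmod (y n))\<^sup>2" by simp
qed

lemma square_summable_bounded_mult:
  assumes "square_summable x" "\<And>n. cmod (c n) \<le> C"
  shows "square_summable (\<lambda>n. c n * x n)"
proof (rule summable_comparison_test')
  show "summable (\<lambda>n. C\<^sup>2 * (cmod (x n))\<^sup>2)"
    using assms(1) by (intro summable_mult)
  fix n
  have "(cmod (c n))\<^sup>2 \<le> C\<^sup>2" using assms(2) by (intro power_mono) auto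
  then show "norm ((cmod (c n * x n))\<^sup>2) \<le> C\<^sup>2 * (cmod (x n))\<^sup>2"
    by (simp add: norm_mult power_mult_distrib mult_right_mono)
qed

lemma square_summable_cmult:
  "square_summable x \<Longrightarrow> square_summable (\<lambda>n. c * x n)"
  by (rule square_summable_bounded_mult[where C = "cmod c"]) auto

lemma square_summable_reindex:
  assumes "square_summable x" "inj g"
  shows "square_summable (\<lambda>n. x (g n))"
  using summable_reindex[OF assms] by (simp add: o_def)

lemma square_summable_tendsto_zero:
  assumes "square_summable x"
  shows "x \<longlonglongrightarrow> 0"
  using tendsto_real_sqrt[OF summable_LIMSEQ_zero[OF assms]]
  by (simp add: tendsto_norm_zero_iff)

lemma square_summable_geometric:
  "cmod \<zeta> < 1 \<Longrightarrow> square_summable (\<lambda>k. \<zeta> ^ k)"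
  by (simp add: norm_power power_mult[symmetric] mult.commute[of _ 2])
     (simp add: power_mult summable_geometric abs_square_less_1)

lemma square_summable_interleave:
  assumes "square_summable p" "square_summable q"
  shows "square_summable (\<lambda>n. if even n then p (n div 2) else q (n div 2))"
proof -
  have "summable (\<lambda>n. if even n then (cmod (p (n div 2)))\<^sup>2 else (cmod (q ((n - 1) div 2)))\<^sup>2)"
    using sums_if[OF summable_sums[OF assms(2)] summable_sums[OF assms(1)]] sums_summable by blast
  moreover have "(\<lambda>n. if even n then (cmod (p (n div 2)))\<^sup>2 else (cmod (q ((n - 1) div 2)))\<^sup>2)
      = (\<lambda>n. (cmod (if even n then p (n div 2) else q (n div 2)))\<^sup>2)"
    by (rule ext) (auto elim: oddE)
  ultimately show ?thesis by simp
qed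

section \<open>Scalar one-step recurrences with square-summable data\<close>

text \<open>Convexity of the square at the combination
  \<open>r * x + (1 - r) * (y / (1 - r))\<close>. The weight of \<open>x\<^sup>2\<close> stays below
  1, so that it can be absorbed.\<close>

lemma convex_square_bound:
  fixes r x y :: real
  assumes "0 \<le> r" "r < 1"
  shows "(r * x + y)\<^sup>2 \<le> r * x\<^sup>2 + y\<^sup>2 / (1 - r)"
proof -
  have "r * x\<^sup>2 + y\<^sup>2 / (1 - r) - (r * x + y)\<^sup>2 = r * ((1 - r) * x - y)\<^sup>2 / (1 - r)"
    using assms by (simp add: divide_simps) (simp add: power2_eq_square algebra_simps)
  moreover have "\<dots> \<ge> 0" using assms by simp
  ultimately show ?thesis by linarith
qed

text \<open>Partial sums are finite, so the term with factor \<open>r < 1\<close> moves to the left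
  and leaves a bound independent of \<open>N\<close>.\<close>

lemma summable_if_contractive:
  fixes X Y :: "nat \<Rightarrow> real"
  assumes r: "0 \<le> r" "r < 1" and X: "\<And>k. 0 \<le> X k" and Y: "summable Y" "\<And>k. 0 \<le> Y k"
    and step: "\<And>N. (\<Sum>k<N. X k) \<le> r * (\<Sum>k<N. X k) + C + (\<Sum>k<N. Y k)"
  shows "summable X"
proof (rule summableI_nonneg_bounded)
  fix N
  have "(1 - r) * (\<Sum>k<N. X k) \<le> C + suminf Y"
    using step[of N] sum_le_suminf[OF Y(1), of "{..<N}"] Y(2) by (simp add: algebra_simps)
  then show "(\<Sum>k<N. X k) \<le> (C + suminf Y) / (1 - r)"
    using r by (simp add: field_simps)
qed (use X in auto)

text \<open>Forward iteration is damped by \<open>\<zeta>\<close>. Starting from 0 makes the index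
  shift in the sum of squares cost nothing.\<close>

lemma stable_recurrence_solution:
  assumes z: "cmod \<zeta> < 1" and g: "square_summable g"
  obtains A where "square_summable A" "\<And>k. A (Suc k) = \<zeta> * A k + g k"
proof
  define A where "A = rec_nat 0 (\<lambda>k x. \<zeta> * x + g k)"
  show rec: "A (Suc k) = \<zeta> * A k + g k" for k by (simp add: A_def)
  show "square_summable A"
  proof (rule summable_if_contractive[where r = "cmod \<zeta>" and C = 0])
    show "summable (\<lambda>k. (cmod (g k))\<^sup>2 / (1 - cmod \<zeta>))" using g by (rule summable_divide)
    fix N
    have step: "(cmod (A (Suc k)))\<^sup>2 \<le> cmod \<zeta> * (cmod (A k))\<^sup>2 + (cmod (g k))\<^sup>2 / (1 - cmod \<zeta>)" for k
    proof -
      have "cmod (A (Suc k)) \<le> cmod \<zeta> * cmod (A k) + cmod (g k)"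
        unfolding rec by (metis norm_mult norm_triangle_ineq)
      then have "(cmod (A (Suc k)))\<^sup>2 \<le> (cmod \<zeta> * cmod (A k) + cmod (g k))\<^sup>2"
        by (intro power_mono) auto
      with convex_square_bound[OF norm_ge_zero z, of "cmod (A k)" "cmod (g k)"] show ?thesis by linarith
    qed
    have "(\<Sum>k<N. (cmod (A k))\<^sup>2) \<le> (\<Sum>k<N. (cmod (A (Suc k)))\<^sup>2)"
    proof -
      have "(\<Sum>k<N. (cmod (A k))\<^sup>2) \<le> (\<Sum>k<Suc N. (cmod (A k))\<^sup>2)" by simp
      also have "\<dots> = (\<Sum>k<N. (cmod (A (Suc k)))\<^sup>2)"
        by (subst sum.lessThan_Suc_shift) (simp add: A_def)
      finally show ?thesis .
    qed
    also have "\<dots> \<le> (\<Sum>k<N. cmod \<zeta> * (cmod (A k))\<^sup>2 + (cmod (g k))\<^sup>2 / (1 - cmod \<zeta>))"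
      by (intro sum_mono step)
    finally show "(\<Sum>k<N. (cmod (A k))\<^sup>2) \<le> cmod \<zeta> * (\<Sum>k<N. (cmod (A k))\<^sup>2) + 0
        + (\<Sum>k<N. (cmod (g k))\<^sup>2 / (1 - cmod \<zeta>))"
      by (simp add: sum.distrib sum_distrib_left)
  qed (use z in auto)
qed

text \<open>Read forwards, the multiplier is the expanding \<open>inverse \<zeta>\<close>; hence the
  equation is solved backwards from infinity by a convergent series.\<close>

lemma unstable_recurrence_solution:
  assumes z: "cmod \<zeta> < 1" and g: "square_summable g"
  obtains B where "square_summable B" "\<And>k. B k = \<zeta> * (B (Suc k) - g k)"
proof
  obtain G where G: "\<And>k. cmod (g k) \<le> G"
    using square_summable_tendsto_zero[OF g] convergent_imp_Bseq convergentI Bseq_def by metis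
  have geo: "summable (\<lambda>i. cmod \<zeta> ^ i * G)"
    using z by (intro summable_mult2 summable_geometric) auto
  have bnd: "norm (\<zeta> ^ i * g (k + i)) \<le> cmod \<zeta> ^ i * G" for i k
    using G by (simp add: norm_mult norm_power mult_left_mono)
  have sm: "summable (\<lambda>i. \<zeta> ^ i * g (k + i))" for k
    by (rule summable_comparison_test'[OF geo]) (use bnd in auto)
  define B where "B k = - \<zeta> * (\<Sum>i. \<zeta> ^ i * g (k + i))" for k
  show rec: "B k = \<zeta> * (B (Suc k) - g k)" for k
  proof -
    have "(\<Sum>i. \<zeta> ^ i * g (k + i)) = g k + (\<Sum>i. \<zeta> ^ Suc i * g (k + Suc i))"
      using suminf_split_head[OF sm[of k]] by simp
    also have "(\<Sum>i. \<zeta> ^ Suc i * g (k + Suc i)) = \<zeta> * (\<Sum>i. \<zeta> ^ i * g (Suc k + i))"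
      using suminf_mult[OF sm[of "Suc k"], of \<zeta>] by (simp add: mult.assoc)
    finally show ?thesis by (simp add: B_def algebra_simps)
  qed
  \<comment> \<open>A crude uniform bound on \<open>B\<close>; it controls the boundary term when
    the sum of squares is shifted by one index.\<close>
  define H where "H = cmod \<zeta> * (\<Sum>i. cmod \<zeta> ^ i * G)"
  have H: "cmod (B k) \<le> H" for k
  proof -
    have "cmod (\<Sum>i. \<zeta> ^ i * g (k + i)) \<le> (\<Sum>i. cmod \<zeta> ^ i * G)"
      by (rule norm_suminf_le[OF _ geo]) (use bnd in auto)
    then show ?thesis by (simp add: B_def H_def norm_mult mult_left_mono)
  qed
  have step: "(cmod (B k))\<^sup>2 \<le> cmod \<zeta> * (cmod (B (Suc k)))\<^sup>2 + (cmod (g k))\<^sup>2 / (1 - cmod \<zeta>)" for k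
  proof -
    have "cmod (B k) \<le> cmod \<zeta> * (cmod (B (Suc k)) + cmod (g k))"
      by (subst rec) (simp add: norm_mult mult_left_mono norm_triangle_ineq4)
    also have "\<dots> \<le> cmod \<zeta> * cmod (B (Suc k)) + cmod (g k)"
      using z mult_right_mono[of "cmod \<zeta>" 1 "cmod (g k)"] by (simp add: algebra_simps)
    finally have "(cmod (B k))\<^sup>2 \<le> (cmod \<zeta> * cmod (B (Suc k)) + cmod (g k))\<^sup>2"
      by (intro power_mono) auto
    with convex_square_bound[OF norm_ge_zero z, of "cmod (B (Suc k))" "cmod (g k)"] show ?thesis by linarith
  qed
  show "square_summable B"
  proof (rule summable_if_contractive[where r = "cmod \<zeta>" and C = "cmod \<zeta> * H\<^sup>2"])
    show "summable (\<lambda>k. (cmod (g k))\<^sup>2 / (1 - cmod \<zeta>))" using g by (rule summable_divide)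
    fix N
    have "(\<Sum>k<N. (cmod (B (Suc k)))\<^sup>2) \<le> (\<Sum>k<Suc N. (cmod (B k))\<^sup>2)"
      by (subst sum.lessThan_Suc_shift) simp
    also have "\<dots> \<le> (\<Sum>k<N. (cmod (B k))\<^sup>2) + H\<^sup>2"
      using H[of N] by (simp add: power_mono)
    finally have shift: "(\<Sum>k<N. (cmod (B (Suc k)))\<^sup>2) \<le> (\<Sum>k<N. (cmod (B k))\<^sup>2) + H\<^sup>2" .
    have "(\<Sum>k<N. (cmod (B k))\<^sup>2)
        \<le> (\<Sum>k<N. cmod \<zeta> * (cmod (B (Suc k)))\<^sup>2 + (cmod (g k))\<^sup>2 / (1 - cmod \<zeta>))"
      by (intro sum_mono step)
    also have "\<dots> = cmod \<zeta> * (\<Sum>k<N. (cmod (B (Suc k)))\<^sup>2) + (\<Sum>k<N. (cmod (g k))\<^sup>2 / (1 - cmod \<zeta>))"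
      by (simp add: sum.distrib sum_distrib_left)
    also have "\<dots> \<le> cmod \<zeta> * ((\<Sum>k<N. (cmod (B k))\<^sup>2) + H\<^sup>2) + (\<Sum>k<N. (cmod (g k))\<^sup>2 / (1 - cmod \<zeta>))"
      using shift by (intro add_right_mono mult_left_mono) auto
    finally show "(\<Sum>k<N. (cmod (B k))\<^sup>2) \<le> cmod \<zeta> * (\<Sum>k<N. (cmod (B k))\<^sup>2) + cmod \<zeta> * H\<^sup>2
        + (\<Sum>k<N. (cmod (g k))\<^sup>2 / (1 - cmod \<zeta>))"
      by (simp add: algebra_simps)
  qed (use z in auto)
qed

text \<open>The matrix M has distinct eigenvalues \<zeta> and \<omega> = 1/\<zeta>. With \<kappa> =
  1/(\<zeta> - \<omega>), the matrices \<kappa>(M - \<omega>) and -\<kappa>(M - \<zeta>) are its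
  spectral projections; the first acts on a forward solution, the second on a backward one.\<close>

lemma hyperbolic_system_solution:
  fixes m11 m12 m21 m22 \<zeta> :: complex
  assumes det: "m11 * m22 - m12 * m21 = 1" and tr: "m11 + m22 = \<zeta> + inverse \<zeta>"
    and z: "\<zeta> \<noteq> 0" "cmod \<zeta> < 1" and f: "square_summable f" and g: "square_summable g"
  obtains p q where "square_summable p" "square_summable q"
    "\<And>k. p (Suc k) = m11 * p k + m12 * q k + f k"
    "\<And>k. q (Suc k) = m21 * p k + m22 * q k + g k"
proof -
  obtain A1 where A1: "square_summable A1" "\<And>k. A1 (Suc k) = \<zeta> * A1 k + f k"
    using stable_recurrence_solution[OF z(2) f] by blast
  obtain A2 where A2: "square_summable A2" "\<And>k. A2 (Suc k) = \<zeta> * A2 k + g k"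
    using stable_recurrence_solution[OF z(2) g] by blast
  obtain B1 where B1: "square_summable B1" "\<And>k. B1 k = \<zeta> * (B1 (Suc k) - f k)"
    using unstable_recurrence_solution[OF z(2) f] by blast
  obtain B2 where B2: "square_summable B2" "\<And>k. B2 k = \<zeta> * (B2 (Suc k) - g k)"
    using unstable_recurrence_solution[OF z(2) g] by blast
  define \<omega> where "\<omega> = inverse \<zeta>"
  have zw: "\<zeta> * \<omega> = 1" using z by (simp add: \<omega>_def)
  have B1': "B1 (Suc k) = \<omega> * B1 k + f k" for k
    using B1(2)[of k] zw by (simp add: mult.assoc[symmetric] mult.commute)
  have B2': "B2 (Suc k) = \<omega> * B2 k + g k" for k
    using B2(2)[of k] zw by (simp add: mult.assoc[symmetric] mult.commute)
  have "\<zeta> \<noteq> \<omega>"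
  proof
    assume "\<zeta> = \<omega>"
    then have "cmod \<zeta> * cmod \<zeta> = 1" using zw by (metis norm_mult norm_one)
    moreover have "cmod \<zeta> * cmod \<zeta> < 1" using z(2) by (simp add: abs_square_less_1 flip: power2_eq_square)
    ultimately show False by simp
  qed
  define \<kappa> where "\<kappa> = 1 / (\<zeta> - \<omega>)"
  have k: "\<kappa> * (\<zeta> - \<omega>) = 1" using \<open>\<zeta> \<noteq> \<omega>\<close> by (simp add: \<kappa>_def)
  \<comment> \<open>Trace and determinant in terms of the eigenvalues; together they encode (M -
    \<zeta>)(M - \<omega>) = 0.\<close>
  have m22: "m22 = \<zeta> + \<omega> - m11" using tr by (simp add: \<omega>_def algebra_simps)
  have m12: "m12 * m21 = m11 * (\<zeta> + \<omega> - m11) - \<zeta> * \<omega>" using det zw m22 by (simp add: algebra_simps)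
  define p where "p k = \<kappa> * ((m11 - \<omega>) * A1 k + m12 * A2 k) - \<kappa> * ((m11 - \<zeta>) * B1 k + m12 * B2 k)" for k
  define q where "q k = \<kappa> * (m21 * A1 k + (m22 - \<omega>) * A2 k) - \<kappa> * (m21 * B1 k + (m22 - \<zeta>) * B2 k)" for k
  show thesis
  proof
    have "square_summable (\<lambda>k. \<kappa> * ((m11 - \<omega>) * A1 k + m12 * A2 k) + (-\<kappa>) * ((m11 - \<zeta>) * B1 k + m12 * B2 k))"
      by (intro square_summable_add square_summable_cmult A1 A2 B1 B2)
    then show "square_summable p" by (simp add: p_def)
    have "square_summable (\<lambda>k. \<kappa> * (m21 * A1 k + (m22 - \<omega>) * A2 k) + (-\<kappa>) * (m21 * B1 k + (m22 - \<zeta>) * B2 k))"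
      by (intro square_summable_add square_summable_cmult A1 A2 B1 B2)
    then show "square_summable q" by (simp add: q_def)
    fix k
    have "p (Suc k) - m11 * p k - m12 * q k - f k = 0"
      unfolding p_def q_def A1(2) A2(2) B1' B2' m22 using m12 k by algebra
    then show "p (Suc k) = m11 * p k + m12 * q k + f k" by (simp add: algebra_simps)
    have "q (Suc k) - m21 * p k - m22 * q k - g k = 0"
      unfolding p_def q_def A1(2) A2(2) B1' B2' m22 using m12 k by algebra
    then show "q (Suc k) = m21 * p k + m22 * q k + g k" by (simp add: algebra_simps)
  qed
qed

section \<open>Off the bands the resolvent equation is solvable\<close>

locale periodic_jacobi =
  fixes a b :: "nat \<Rightarrow> real"
  assumes a_pos: "\<And>n. a n > 0"
    and a_per: "\<And>n. a (n + 2) = a n"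
    and b_per: "\<And>n. n \<ge> 1 \<Longrightarrow> b (n + 2) = b n"
begin

abbreviation u where "u \<equiv> u_fun a b"

lemma a_nz [simp]: "a n \<noteq> 0"
  using a_pos[of n] by simp

lemma a_even: "a (2 * k) = a 0" and a_odd: "a (Suc (2 * k)) = a 1"
  and b_odd: "b (Suc (2 * k)) = b 1" and b_even: "b (Suc (Suc (2 * k))) = b 2"
proof (induction k)
  case (Suc k)
  show "a (2 * Suc k) = a 0" "a (Suc (2 * Suc k)) = a 1" "b (Suc (2 * Suc k)) = b 1"
    "b (Suc (Suc (2 * Suc k))) = b 2"
    using Suc a_per[of "2 * k"] a_per[of "Suc (2 * k)"] b_per[of "Suc (2 * k)"] b_per[of "Suc (Suc (2 * k))"]
    by (simp_all add: numeral_2_eq_2)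
qed (auto simp: numeral_2_eq_2)

lemma a_values: "a n = a 0 \<or> a n = a 1"
  by (cases "even n") (auto elim!: evenE oddE simp: a_even a_odd)

text \<open>Periodicity of \<open>b\<close> starts at index 1, so \<open>b 0\<close> counts as a
  third value.\<close>

lemma b_values: "b n = b 0 \<or> b n = b 1 \<or> b n = b 2"
proof (cases n)
  case (Suc m)
  then show ?thesis by (cases "even m") (auto elim!: evenE oddE simp: b_even b_odd)
qed auto

lemma a_bound: "a n \<le> a 0 + a 1"
  using a_values[of n] a_pos[of 0] a_pos[of 1] by auto

lemma b_bound: "\<bar>b n\<bar> \<le> \<bar>b 0\<bar> + \<bar>b 1\<bar> + \<bar>b 2\<bar>"
  using b_values[of n] by auto

lemma sin_sol_2: "sin_sol a b 2 z = (z - b 1) / a 1"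
  by (simp add: sin_sol_def numeral_2_eq_2)

lemma cos_sol_2: "cos_sol a b 2 z = - (a 0 / a 1)"
  by (simp add: cos_sol_def numeral_2_eq_2)

lemma u_eq: "u z = ((z - b 1) * (z - b 2) - (a 1)\<^sup>2 - (a 0)\<^sup>2) / (2 * a 0 * a 1)"
proof -
  have "a 2 = a 0" using a_per[of 0] by (simp add: numeral_2_eq_2)
  then have sin3: "sin_sol a b 3 z = ((z - b 2) * ((z - b 1) / a 1) - a 1) / a 0"
    by (simp add: sin_sol_def numeral_3_eq_3 numeral_2_eq_2)
  show ?thesis unfolding u_fun_def cos_sol_2 sin3
    by (simp add: field_simps power2_eq_square)
qed

lemma u_mult: "2 * u z * a 0 * a 1 = (z - b 1) * (z - b 2) - (a 1)\<^sup>2 - (a 0)\<^sup>2"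
  unfolding u_eq by (simp add: field_simps)

lemma jacobi_op_minus_in_ell2:
  assumes "y \<in> ell2"
  shows "(\<lambda>n. jacobi_op a b y n - z * y n) \<in> ell2"
proof -
  from assms have y: "square_summable y" "y 0 = 0" by (auto simp: ell2_def)
  have m: "square_summable (\<lambda>n. y (n + 1))"
    using square_summable_reindex[OF y(1), of "\<lambda>n. n + 1"] by simp
  have p: "square_summable (\<lambda>n. y (n - 1))"
    using y(1) by (subst summable_Suc_iff[symmetric]) simp
  have ab: "cmod (of_real (a n)) \<le> a 0 + a 1"
    "cmod (of_real (if n = 0 then 0 else b n) - z) \<le> (\<bar>b 0\<bar> + \<bar>b 1\<bar> + \<bar>b 2\<bar>) + cmod z" for n
    using a_bound[of n] a_pos[of n] b_bound[of n]
      norm_triangle_ineq4[of "of_real (if n = 0 then 0 else b n)" z]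
    by (auto split: if_splits)
  \<comment> \<open>The coefficients of the neighbours are cut to 0 at index 0, where
    \<open>jacobi_op\<close> is 0 by convention.\<close>
  have "square_summable (\<lambda>n. of_real (if n = 0 then 0 else a (n - 1)) * y (n - 1)
      + (of_real (if n = 0 then 0 else b n) - z) * y n + of_real (if n = 0 then 0 else a n) * y (n + 1))"
    using a_bound a_pos[of 0] a_pos[of 1] less_imp_le[OF a_pos]
    by (intro square_summable_add square_summable_bounded_mult[where C = "a 0 + a 1", OF p]
        square_summable_bounded_mult[OF y(1) ab(2)]
        square_summable_bounded_mult[where C = "a 0 + a 1", OF m]) auto
  moreover have "(\<lambda>n. of_real (if n = 0 then 0 else a (n - 1)) * y (n - 1)
      + (of_real (if n = 0 then 0 else b n) - z) * y n + of_real (if n = 0 then 0 else a n) * y (n + 1))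
    = (\<lambda>n. jacobi_op a b y n - z * y n)"
    by (rule ext) (auto simp: jacobi_op_def algebra_simps y(2))
  ultimately have "square_summable (\<lambda>n. jacobi_op a b y n - z * y n)" by metis
  moreover have "jacobi_op a b y 0 - z * y 0 = 0" by (simp add: jacobi_op_def y(2))
  ultimately show ?thesis by (simp add: ell2_def)
qed

text \<open>Storing the even entries in \<open>p\<close> and the odd ones in \<open>q\<close> turns
  the Jacobi equation into a first-order system over one period; \<open>p 0 = 0\<close> is the
  boundary condition at index 0.\<close>

lemma interleaved_jacobi_op:
  fixes p q f :: "nat \<Rightarrow> complex" and z :: complex
  defines "y \<equiv> \<lambda>n. if even n then p (n div 2) else q (n div 2)"
  assumes pq: "square_summable p" "square_summable q" and p0: "p 0 = 0" and f0: "f 0 = 0"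
    and odd: "\<And>k. a 0 * p k + (b 1 - z) * q k + a 1 * p (Suc k) = f (Suc (2 * k))"
    and even: "\<And>k. a 1 * q k + (b 2 - z) * p (Suc k) + a 0 * q (Suc k) = f (Suc (Suc (2 * k)))"
  shows "y \<in> ell2" "(\<lambda>n. jacobi_op a b y n - z * y n) = f"
proof -
  show "y \<in> ell2"
    using square_summable_interleave[OF pq] p0 by (simp add: ell2_def y_def)
  show "(\<lambda>n. jacobi_op a b y n - z * y n) = f"
  proof
    fix n
    consider "n = 0" | k where "n = Suc (2 * k)" | k where "n = Suc (Suc (2 * k))"
      by (metis Suc_double_not_eq_double evenE not0_implies_Suc oddE Suc_eq_plus1 even_Suc)
    then show "jacobi_op a b y n - z * y n = f n"
    proof cases
      case 1 then show ?thesis by (simp add: jacobi_op_def y_def p0 f0)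
    next
      case 2 then show ?thesis using odd[of k]
        by (simp add: jacobi_op_def y_def a_even a_odd b_odd) (simp add: algebra_simps)
    next
      case 3
      have "a (Suc (Suc (2 * k))) = a 0" using a_even[of "Suc k"] by simp
      with 3 show ?thesis using even[of k]
        by (simp add: jacobi_op_def y_def a_odd b_even) (simp add: algebra_simps)
    qed
  qed
qed

text \<open>The hyperbolic system has a square-summable solution, possibly with a wrong value at
  index 0. A multiple of the decaying homogeneous solution repairs this unless that solution
  vanishes at 0, and then it is an eigenvector.\<close>

lemma hyperbolic_not_in_continuous_spectrum:
  assumes z: "\<zeta> \<noteq> 0" "cmod \<zeta> < 1" and u: "\<zeta> + inverse \<zeta> = 2 * u x"
  shows "x \<notin> continuous_spectrum (jacobi_op a b)"
proof
  assume "x \<in> continuous_spectrum (jacobi_op a b)"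
  then have inj: "inj_on (\<lambda>y n. jacobi_op a b y n - x * y n) ell2"
    and nsurj: "(\<lambda>y n. jacobi_op a b y n - x * y n) ` ell2 \<noteq> ell2"
    by (auto simp: continuous_spectrum_def)
  \<comment> \<open>The monodromy matrix, taking the entries at \<open>2 * k\<close> and
    \<open>2 * k + 1\<close> to the next such pair.\<close>
  define m11 m12 m21 m22 where m: "m11 = - (complex_of_real (a 0) / a 1)" "m12 = (x - b 1) / a 1"
    "m21 = - ((x - b 2) / a 1)" "m22 = ((x - b 1) * (x - b 2) - (a 1)\<^sup>2) / (a 0 * a 1)"
  have det: "m11 * m22 - m12 * m21 = 1" unfolding m
    by (simp add: field_simps power2_eq_square)
  have tr: "m11 + m22 = \<zeta> + inverse \<zeta>" unfolding u u_eq m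
    by (simp add: field_simps power2_eq_square)
  have solve: "\<exists>y\<in>ell2. (\<lambda>n. jacobi_op a b y n - x * y n) = f"
    if pq: "square_summable p" "square_summable q" "p 0 = 0" "f 0 = 0"
      and p: "\<And>k. p (Suc k) = m11 * p k + m12 * q k + f (Suc (2 * k)) / a 1"
      and q: "\<And>k. q (Suc k) = m21 * p k + m22 * q k
                + (f (Suc (Suc (2 * k))) + (x - b 2) / a 1 * f (Suc (2 * k))) / a 0"
    for p q f :: "nat \<Rightarrow> complex"
  proof -
    have "a 0 * p k + (b 1 - x) * q k + a 1 * p (Suc k) = f (Suc (2 * k))" for k
      unfolding p m by (simp add: field_simps)
    moreover have "a 1 * q k + (b 2 - x) * p (Suc k) + a 0 * q (Suc k) = f (Suc (Suc (2 * k)))" for k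
      unfolding p q m by (simp add: field_simps power2_eq_square)
    ultimately have "(\<lambda>n. if even n then p (n div 2) else q (n div 2)) \<in> ell2"
      "(\<lambda>n. jacobi_op a b (\<lambda>n. if even n then p (n div 2) else q (n div 2)) n
         - x * (if even n then p (n div 2) else q (n div 2))) = f"
      using interleaved_jacobi_op[of p q f x, OF pq] by simp_all
    then show ?thesis by (intro bexI)
  qed
  show False
  \<comment> \<open>Precisely the case in which the stable eigenvector has first component
    0.\<close>
  proof (cases "m12 = 0 \<and> m11 = inverse \<zeta>")
    case True
    then have m12: "m12 = 0" and m22: "m22 = \<zeta>" using tr by auto
    \<comment> \<open>The sine solution at \<open>x = b 1\<close>: the sequence 0, 1, 0, \<zeta>, 0,
      ...\<close>
    define y :: "nat \<Rightarrow> complex" where "y = (\<lambda>n. if even n then 0 else \<zeta> ^ (n div 2))"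
    have b1: "x = b 1" using m12 by (simp add: m)
    have "square_summable (\<lambda>k. \<zeta> ^ k)" by (rule square_summable_geometric[OF z(2)])
    moreover have "a 1 * \<zeta> ^ k + a 0 * \<zeta> ^ Suc k = 0" for k
    proof -
      have "\<zeta> = - (a 1 / a 0)" using m22 b1 by (simp add: m field_simps power2_eq_square)
      then have "a 1 + a 0 * \<zeta> = 0" by simp
      then show ?thesis by (metis mult_zero_right power_Suc2 distrib_left mult.commute mult.left_commute)
    qed
    ultimately have "y \<in> ell2" "(\<lambda>n. jacobi_op a b y n - x * y n) = (\<lambda>n. 0)"
      using interleaved_jacobi_op[of "\<lambda>_. 0" "\<lambda>k. \<zeta> ^ k" "\<lambda>_. 0" x]
      by (auto simp: y_def b1)
    moreover have "(\<lambda>n. 0) \<in> ell2"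
      "(\<lambda>n. jacobi_op a b (\<lambda>n. 0) n - x * (\<lambda>n. 0) n) = (\<lambda>n. 0 :: complex)"
      by (auto simp: ell2_def jacobi_op_def)
    ultimately have "y = (\<lambda>n. 0)" by - (rule inj_onD[OF inj], simp_all)
    then have "y 1 = 0" by simp
    then show False by (simp add: y_def)
  next
    case False
    \<comment> \<open>The stable eigenvector. If \<open>m12 = 0\<close> it is the first column of M
      - 1/\<zeta>; otherwise its first component can be taken as \<open>m12\<close>.\<close>
    obtain c1 c2 where c: "c1 \<noteq> 0" "m11 * c1 + m12 * c2 = \<zeta> * c1" "m21 * c1 + m22 * c2 = \<zeta> * c2"
    proof (cases "m12 = 0")
      case True
      have m22: "m22 = \<zeta> + inverse \<zeta> - m11" using tr by algebra
      have "(m11 - inverse \<zeta>) * (m11 - \<zeta>) = 0"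
        using det True z unfolding m22 by (simp add: field_simps)
      then have "m11 = \<zeta>" using False True by auto
      then show thesis using that[of "m11 - inverse \<zeta>" m21] True False det m22 z
        by (simp add: field_simps)
    next
      case F: False
      have m22: "m22 = \<zeta> + inverse \<zeta> - m11" using tr by algebra
      show thesis
      proof (rule that[of m12 "\<zeta> - m11"])
        have "\<zeta> * inverse \<zeta> = 1" using z by simp
        then show "m21 * m12 + m22 * (\<zeta> - m11) = \<zeta> * (\<zeta> - m11)"
          using det unfolding m22 by algebra
      qed (use F in \<open>auto simp: algebra_simps\<close>)
    qed
    have "f \<in> (\<lambda>y n. jacobi_op a b y n - x * y n) ` ell2" if f: "f \<in> ell2" for f
    proof -
      have f: "square_summable f" "f 0 = 0" using f by (auto simp: ell2_def)
      have f1: "square_summable (\<lambda>k. f (Suc (2 * k)))"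
        by (rule square_summable_reindex[OF f(1)]) (auto simp: inj_on_def)
      have f2: "square_summable (\<lambda>k. f (Suc (Suc (2 * k))))"
        by (rule square_summable_reindex[OF f(1)]) (auto simp: inj_on_def)
      have F: "square_summable (\<lambda>k. f (Suc (2 * k)) / a 1)"
        using square_summable_cmult[OF f1, of "1 / a 1"] by simp
      have G: "square_summable (\<lambda>k. (f (Suc (Suc (2 * k))) + (x - b 2) / a 1 * f (Suc (2 * k))) / a 0)"
        using square_summable_cmult[OF square_summable_add[OF f2 square_summable_cmult[OF f1, of "(x - b 2) / a 1"]], of "1 / a 0"]
        by simp
      obtain p q where pq: "square_summable p" "square_summable q"
        "\<And>k. p (Suc k) = m11 * p k + m12 * q k + f (Suc (2 * k)) / a 1"
        "\<And>k. q (Suc k) = m21 * p k + m22 * q k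
                + (f (Suc (Suc (2 * k))) + (x - b 2) / a 1 * f (Suc (2 * k))) / a 0"
        using hyperbolic_system_solution[OF det tr z F G] by blast
      \<comment> \<open>Chosen to cancel the value \<open>p 0\<close> at index 0.\<close>
      define t where "t = - p 0 / c1"
      have eig: "t * v * (\<zeta> * s) = v1 * (t * c1 * s) + v2 * (t * c2 * s)"
        if "v1 * c1 + v2 * c2 = \<zeta> * v" for v v1 v2 s
        using that by algebra
      note geo = square_summable_geometric[OF z(2)]
      have "\<exists>y\<in>ell2. (\<lambda>n. jacobi_op a b y n - x * y n) = f"
      proof (rule solve)
        show "square_summable (\<lambda>k. p k + t * c1 * \<zeta> ^ k)" "square_summable (\<lambda>k. q k + t * c2 * \<zeta> ^ k)"
          by (intro square_summable_add square_summable_cmult pq geo)+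
        show "p 0 + t * c1 * \<zeta> ^ 0 = 0" using c by (simp add: t_def)
        fix k
        show "p (Suc k) + t * c1 * \<zeta> ^ Suc k = m11 * (p k + t * c1 * \<zeta> ^ k) + m12 * (q k + t * c2 * \<zeta> ^ k)
            + f (Suc (2 * k)) / a 1"
          using eig[OF c(2), of "\<zeta> ^ k"] by (simp add: pq(3) algebra_simps)
        show "q (Suc k) + t * c2 * \<zeta> ^ Suc k = m21 * (p k + t * c1 * \<zeta> ^ k) + m22 * (q k + t * c2 * \<zeta> ^ k)
            + (f (Suc (Suc (2 * k))) + (x - b 2) / a 1 * f (Suc (2 * k))) / a 0"
          using eig[OF c(3), of "\<zeta> ^ k"] by (simp add: pq(4) algebra_simps)
      qed (use f in auto)
      then show ?thesis by force
    qed
    then show False using nsurj jacobi_op_minus_in_ell2[of _ x] by blast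
  qed
qed

end

section \<open>Solutions inside the bands\<close>

context
  fixes x :: "nat \<Rightarrow> complex" and r :: real
  assumes rec: "\<And>k. x (Suc (Suc k)) = 2 * r * x (Suc k) - x k" and r: "\<bar>r\<bar> < 1"
begin

text \<open>The recurrence has determinant 1 and trace \<open>2 * r\<close>, and this is the
  Hermitian form it preserves; it is definite for \<open>\<bar>r\<bar> < 1\<close>.\<close>

lemma elliptic_form_invariant:
  "(cmod (x (Suc k)))\<^sup>2 + (cmod (x k))\<^sup>2 - 2 * r * Re (x (Suc k) * cnj (x k))
     = (cmod (x 1))\<^sup>2 + (cmod (x 0))\<^sup>2 - 2 * r * Re (x 1 * cnj (x 0))"
proof (induction k)
  case (Suc k)
  have "(cmod (x (Suc (Suc k))))\<^sup>2 + (cmod (x (Suc k)))\<^sup>2 - 2 * r * Re (x (Suc (Suc k)) * cnj (x (Suc k)))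
      = (cmod (x (Suc k)))\<^sup>2 + (cmod (x k))\<^sup>2 - 2 * r * Re (x (Suc k) * cnj (x k))"
    unfolding rec cmod_power2 by (simp add: power2_eq_square algebra_simps)
  with Suc show ?case by simp
qed simp

text \<open>Coercivity: the cross term is at most |r| times the sum of the two squares.\<close>

lemma elliptic_form_bound:
  "(1 - \<bar>r\<bar>) * (cmod (x k))\<^sup>2 \<le> (cmod (x 1))\<^sup>2 + (cmod (x 0))\<^sup>2 - 2 * r * Re (x 1 * cnj (x 0))"
proof -
  have "2 * r * Re (x (Suc k) * cnj (x k)) \<le> \<bar>r\<bar> * (2 * (cmod (x (Suc k)) * cmod (x k)))"
  proof -
    have "r * Re (x (Suc k) * cnj (x k)) \<le> \<bar>r\<bar> * \<bar>Re (x (Suc k) * cnj (x k))\<bar>"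
      by (metis abs_ge_self abs_mult)
    also have "\<dots> \<le> \<bar>r\<bar> * (cmod (x (Suc k)) * cmod (x k))"
      using abs_Re_le_cmod[of "x (Suc k) * cnj (x k)"] by (intro mult_left_mono) (auto simp: norm_mult)
    finally show ?thesis by simp
  qed
  also have "\<dots> \<le> \<bar>r\<bar> * ((cmod (x (Suc k)))\<^sup>2 + (cmod (x k))\<^sup>2)"
    using sum_squares_bound[of "cmod (x (Suc k))" "cmod (x k)"] by (intro mult_left_mono) auto
  finally have "(1 - \<bar>r\<bar>) * ((cmod (x (Suc k)))\<^sup>2 + (cmod (x k))\<^sup>2)
      \<le> (cmod (x 1))\<^sup>2 + (cmod (x 0))\<^sup>2 - 2 * r * Re (x 1 * cnj (x 0))"
    using elliptic_form_invariant[of k] by (simp add: algebra_simps)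
  moreover have "(1 - \<bar>r\<bar>) * (cmod (x (Suc k)))\<^sup>2 \<ge> 0" using r by simp
  ultimately show ?thesis by (simp add: algebra_simps)
qed

lemma elliptic_recurrence_bounded: "\<exists>C. \<forall>k. cmod (x k) \<le> C"
proof -
  define Q where "Q = (cmod (x 1))\<^sup>2 + (cmod (x 0))\<^sup>2 - 2 * r * Re (x 1 * cnj (x 0))"
  have "cmod (x k) \<le> sqrt (Q / (1 - \<bar>r\<bar>))" for k
    using elliptic_form_bound[of k] r by (intro real_le_rsqrt) (simp add: Q_def field_simps)
  then show ?thesis by blast
qed

text \<open>The form is constant along the sequence and tends to 0, so it is 0; coercivity then
  kills every term.\<close>

lemma elliptic_recurrence_decay:
  assumes "x \<longlonglongrightarrow> 0"
  shows "x k = 0"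
proof -
  have "(\<lambda>k. (cmod (x (Suc k)))\<^sup>2 + (cmod (x k))\<^sup>2 - 2 * r * Re (x (Suc k) * cnj (x k)))
      \<longlonglongrightarrow> (cmod 0)\<^sup>2 + (cmod 0)\<^sup>2 - 2 * r * Re (0 * cnj 0)"
    by (intro tendsto_intros assms LIMSEQ_Suc[OF assms])
  then have "(cmod (x 1))\<^sup>2 + (cmod (x 0))\<^sup>2 - 2 * r * Re (x 1 * cnj (x 0)) = 0"
    unfolding elliptic_form_invariant by (simp add: LIMSEQ_const_iff)
  with elliptic_form_bound[of k] have "(1 - \<bar>r\<bar>) * (cmod (x k))\<^sup>2 \<le> 0" by simp
  with r show ?thesis by (simp add: mult_le_0_iff)
qed

end

section \<open>Bounded and decaying Jacobi solutions through the two-step recurrence\<close>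

context periodic_jacobi
begin

text \<open>Cayley-Hamilton for the monodromy over one period, with trace \<open>2 * u z\<close> and
  determinant 1, obtained by eliminating the two intermediate entries.\<close>

lemma homogeneous_even_step:
  fixes y :: "nat \<Rightarrow> complex" and z :: complex
  assumes y: "\<And>n. n \<ge> m \<Longrightarrow> a n * y n + (b (Suc n) - z) * y (Suc n) + a (Suc n) * y (Suc (Suc n)) = 0"
    and n: "n \<ge> m"
  shows "y (Suc (Suc (Suc (Suc n)))) = 2 * u z * y (Suc (Suc n)) - y n"
proof -
  have per: "a (Suc (Suc n)) = a n" "a (Suc (Suc (Suc n))) = a (Suc n)"
    "b (Suc (Suc (Suc n))) = b (Suc n)"
    using a_per[of n] a_per[of "Suc n"] b_per[of "Suc n"] by simp_all
  have e: "a n * y n + (b (Suc n) - z) * y (Suc n) + a (Suc n) * y (Suc (Suc n)) = 0"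
    "a (Suc n) * y (Suc n) + (b (Suc (Suc n)) - z) * y (Suc (Suc n)) + a n * y (Suc (Suc (Suc n))) = 0"
    "a n * y (Suc (Suc n)) + (b (Suc n) - z) * y (Suc (Suc (Suc n))) + a (Suc n) * y (Suc (Suc (Suc (Suc n)))) = 0"
    using y[of n] y[of "Suc n"] y[of "Suc (Suc n)"] n by (simp_all add: per)
  \<comment> \<open>The discriminant is symmetric under the exchange of the two sites of a period,
    so the parity of \<open>n\<close> does not matter.\<close>
  have u: "2 * u z * a n * a (Suc n)
      = (z - b (Suc n)) * (z - b (Suc (Suc n))) - (a n)\<^sup>2 - (a (Suc n))\<^sup>2"
  proof (cases "even n")
    case True
    then obtain k where "n = 2 * k" by (elim evenE)
    then show ?thesis using u_mult[of z] a_even[of k] a_odd[of k] b_odd[of k] b_even[of k]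
      by (simp add: algebra_simps)
  next
    case False
    then obtain k where k: "n = Suc (2 * k)" by (auto elim: oddE)
    have "b (Suc (Suc (Suc (2 * k)))) = b 1" "a (Suc (Suc (2 * k))) = a 0"
      using b_odd[of "Suc k"] a_even[of "Suc k"] by simp_all
    with k show ?thesis using u_mult[of z] a_odd[of k] b_even[of k]
      by (simp add: algebra_simps)
  qed
  have "of_real (a n) * of_real (a (Suc n)) * (y (Suc (Suc (Suc (Suc n)))) - (2 * u z * y (Suc (Suc n)) - y n)) = 0"
    using e u unfolding of_real_power by algebra
  then show ?thesis by simp
qed

text \<open>The elliptic decay result is applied to the subsequence of step 2 that starts at
  \<open>n\<close> itself.\<close>

lemma homogeneous_decay:
  fixes y :: "nat \<Rightarrow> complex" and z :: complex
  assumes y: "\<And>n. n \<ge> m \<Longrightarrow> a n * y n + (b (Suc n) - z) * y (Suc n) + a (Suc n) * y (Suc (Suc n)) = 0"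
    and u: "u z = of_real r" "\<bar>r\<bar> < 1" and lim: "y \<longlonglongrightarrow> 0" and n: "n \<ge> m"
  shows "y n = 0"
proof -
  have "filterlim (\<lambda>k. n + 2 * k) at_top sequentially"
    by (rule filterlim_subseq) (auto simp: strict_mono_def)
  then have lim': "(\<lambda>k. y (n + 2 * k)) \<longlonglongrightarrow> 0" by (rule filterlim_compose[OF lim])
  have rec: "y (n + 2 * Suc (Suc k)) = 2 * r * y (n + 2 * Suc k) - y (n + 2 * k)" for k
    using homogeneous_even_step[OF y, of m "n + 2 * k"] n by (simp add: u)
  show ?thesis using elliptic_recurrence_decay[of "\<lambda>k. y (n + 2 * k)" r, OF rec u(2) lim', of 0] by simp
qed

text \<open>From \<open>m\<close> on, two interlaced subsequences obey the elliptic recurrence; the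
  finitely many earlier entries are bounded by their maximum.\<close>

lemma homogeneous_bounded:
  fixes y :: "nat \<Rightarrow> complex" and z :: complex
  assumes y: "\<And>n. n \<ge> m \<Longrightarrow> a n * y n + (b (Suc n) - z) * y (Suc n) + a (Suc n) * y (Suc (Suc n)) = 0"
    and u: "u z = of_real r" "\<bar>r\<bar> < 1"
  shows "\<exists>C. \<forall>n. cmod (y n) \<le> C"
proof -
  have "\<exists>C. \<forall>k. cmod (y (n + 2 * k)) \<le> C" if n: "n \<ge> m" for n
  proof (rule elliptic_recurrence_bounded)
    show "y (n + 2 * Suc (Suc k)) = 2 * r * y (n + 2 * Suc k) - y (n + 2 * k)" for k
      using homogeneous_even_step[OF y, of m "n + 2 * k"] n by (simp add: u)
  qed (rule u)
  then obtain C1 C2 where C: "\<And>k. cmod (y (m + 2 * k)) \<le> C1" "\<And>k. cmod (y (Suc m + 2 * k)) \<le> C2"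
    by (meson le_refl le_SucI)
  define C0 where "C0 = Max ((\<lambda>n. cmod (y n)) ` {..m})"
  have "cmod (y n) \<le> max C0 (max C1 C2)" for n
  proof (cases "n \<le> m")
    case True
    then have "cmod (y n) \<le> C0" unfolding C0_def by (intro Max_ge) auto
    then show ?thesis by simp
  next
    case False
    then obtain j where j: "n = m + j" using le_Suc_ex nat_le_linear by blast
    show ?thesis
    proof (cases "even j")
      case True
      then show ?thesis using C(1) j by (metis evenE max.coboundedI1 max.coboundedI2)
    next
      case False
      then obtain k where "j = Suc (2 * k)" by (auto elim: oddE)
      then show ?thesis using C(2)[of k] j by (simp add: le_max_iff_disj)
    qed
  qed
  then show ?thesis by blast
qed

text \<open>Forward recursion from two zero entries; past \<open>K\<close> the equation is
  homogeneous, which bounds the solution.\<close>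

lemma bounded_truncated_solution:
  fixes f :: "nat \<Rightarrow> complex" and z :: complex
  assumes u: "u z = of_real r" "\<bar>r\<bar> < 1"
  obtains Y :: "nat \<Rightarrow> complex" and C where "Y 0 = 0" "\<And>n. cmod (Y n) \<le> C"
    "\<And>n. n \<ge> 1 \<Longrightarrow> jacobi_op a b Y n - z * Y n = (if n \<le> K then f n else 0)"
proof -
  define F where "F n = (if n \<le> K then f n else (0 :: complex))" for n
  \<comment> \<open>The state at \<open>n\<close> is the pair of the entries at \<open>n\<close> and
    \<open>Suc n\<close>.\<close>
  define P where "P = rec_nat (0 :: complex, 0 :: complex)
     (\<lambda>n (s, t). (t, (F (Suc n) - a n * s - (b (Suc n) - z) * t) / a (Suc n)))"
  define Y where "Y n = fst (P n)" for n
  have snd: "snd (P n) = Y (Suc n)" for n by (simp add: Y_def P_def case_prod_beta)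
  have rec: "Y (Suc (Suc n)) = (F (Suc n) - a n * Y n - (b (Suc n) - z) * Y (Suc n)) / a (Suc n)" for n
    unfolding snd[symmetric] by (simp add: P_def case_prod_beta) (simp add: P_def[symmetric] Y_def snd)
  have eq: "a n * Y n + (b (Suc n) - z) * Y (Suc n) + a (Suc n) * Y (Suc (Suc n)) = F (Suc n)" for n
    by (subst rec) (simp add: field_simps)
  obtain C where C: "\<And>n. cmod (Y n) \<le> C"
    using homogeneous_bounded[of K Y z r] u by (auto simp: eq F_def)
  show thesis
  proof (rule that)
    show "Y 0 = 0" by (simp add: Y_def P_def)
    show "cmod (Y n) \<le> C" for n by (rule C)
    fix n :: nat assume "n \<ge> 1"
    then obtain m where "n = Suc m" by (cases n) auto
    then show "jacobi_op a b Y n - z * Y n = (if n \<le> K then f n else 0)"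
      using eq[of m] by (simp add: jacobi_op_def F_def algebra_simps)
  qed
qed

end

lemma suminf_le_sums:
  fixes f g :: "nat \<Rightarrow> real"
  assumes "\<And>n. 0 \<le> f n" "\<And>n. f n \<le> g n" "g sums s"
  shows "suminf f \<le> s"
proof -
  have "summable f"
    by (rule summable_comparison_test'[OF sums_summable[OF assms(3)]]) (use assms in auto)
  then show ?thesis
    using suminf_le[OF assms(2) _ sums_summable[OF assms(3)]] sums_unique[OF assms(3)] by simp
qed

text \<open>The two roots have product 1, so one is inside the unit disk unless both lie on the
  circle; they are then conjugate and \<open>v\<close> is real in [-1, 1].\<close>

lemma joukowski_root_exists:
  fixes v :: complex
  assumes "\<And>r. \<bar>r\<bar> \<le> 1 \<Longrightarrow> v \<noteq> of_real r"
  obtains \<zeta> where "\<zeta> \<noteq> 0" "cmod \<zeta> < 1" "\<zeta> + inverse \<zeta> = 2 * v"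
proof -
  define c where "c = csqrt (v\<^sup>2 - 1)"
  define \<xi> where "\<xi> = v + c"
  have prod: "\<xi> * (v - c) = 1"
    using power2_csqrt[of "v\<^sup>2 - 1"] by (simp add: \<xi>_def c_def algebra_simps power2_eq_square)
  then have nz: "\<xi> \<noteq> 0" by auto
  have inv: "inverse \<xi> = v - c" using prod by (simp add: inverse_unique)
  have sum: "\<xi> + inverse \<xi> = 2 * v" unfolding inv by (simp add: \<xi>_def)
  have "cmod \<xi> \<noteq> 1"
  proof
    assume 1: "cmod \<xi> = 1"
    then have "\<xi> * cnj \<xi> = 1" by (simp add: complex_norm_square[symmetric])
    then have "inverse \<xi> = cnj \<xi>" by (rule inverse_unique)
    with sum have "v = of_real (Re \<xi>)" by (simp add: complex_add_cnj)
    moreover have "\<bar>Re \<xi>\<bar> \<le> 1" using abs_Re_le_cmod[of \<xi>] 1 by simp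
    ultimately show False using assms by blast
  qed
  then have "cmod \<xi> < 1 \<or> cmod (inverse \<xi>) < 1"
    using nz by (auto simp: norm_inverse inverse_less_1_iff neq_iff)
  then consider "cmod \<xi> < 1" | "cmod (inverse \<xi>) < 1" by blast
  then show thesis
  proof cases
    case 1 then show ?thesis using that nz sum by blast
  next
    case 2 then show ?thesis using that[of "inverse \<xi>"] nz sum by (simp add: add.commute)
  qed
qed

section \<open>Points with real discriminant in (-1, 1) are continuous spectrum\<close>

context periodic_jacobi
begin

lemma jacobi_op_Suc:
  fixes y :: "nat \<Rightarrow> complex" and z :: complex
  shows
  "jacobi_op a b y (Suc m) - z * y (Suc m)
     = a m * y m + (b (Suc m) - z) * y (Suc m) + a (Suc m) * y (Suc (Suc m))"
  by (simp add: jacobi_op_def algebra_simps)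

lemma elliptic_inj:
  assumes u: "u z = of_real r" "\<bar>r\<bar> < 1"
  shows "inj_on (\<lambda>y n. jacobi_op a b y n - z * y n) ell2"
proof (rule inj_onI)
  fix y y' :: "nat \<Rightarrow> complex"
  assume y: "y \<in> ell2" "y' \<in> ell2"
    and eq: "(\<lambda>n. jacobi_op a b y n - z * y n) = (\<lambda>n. jacobi_op a b y' n - z * y' n)"
  have "(\<lambda>n. y n - y' n) \<longlonglongrightarrow> 0 - 0"
    using y by (intro tendsto_diff square_summable_tendsto_zero) (auto simp: ell2_def)
  moreover have "a n * (y n - y' n) + (b (Suc n) - z) * (y (Suc n) - y' (Suc n))
      + a (Suc n) * (y (Suc (Suc n)) - y' (Suc (Suc n))) = 0" for n
    using fun_cong[OF eq, of "Suc n"] by (simp only: jacobi_op_Suc) (simp add: algebra_simps)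
  ultimately have "y n - y' n = 0" for n
    using homogeneous_decay[of 0 "\<lambda>n. y n - y' n" z r n] u by simp
  then show "y = y'" by auto
qed

text \<open>The unit vector at index 1 is missed: a preimage is homogeneous from index 2 on and
  decays, so it vanishes, but the equation at index 1 would then read 0 = 1.\<close>

lemma elliptic_not_surj:
  assumes u: "u z = of_real r" "\<bar>r\<bar> < 1"
  shows "(\<lambda>y n. jacobi_op a b y n - z * y n) ` ell2 \<noteq> ell2"
proof
  assume onto: "(\<lambda>y n. jacobi_op a b y n - z * y n) ` ell2 = ell2"
  define f :: "nat \<Rightarrow> complex" where "f n = (if n = 1 then 1 else 0)" for n
  have "summable (\<lambda>n. (cmod (f n))\<^sup>2)"
    by (rule summable_finite[of "{1}"]) (auto simp: f_def)
  then have "f \<in> ell2" by (simp add: ell2_def f_def)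
  then obtain y where y: "y \<in> ell2" and eq: "f = (\<lambda>n. jacobi_op a b y n - z * y n)"
    using onto by blast
  have hom: "a n * y n + (b (Suc n) - z) * y (Suc n) + a (Suc n) * y (Suc (Suc n)) = f (Suc n)" for n
    using jacobi_op_Suc[of y n z] by (simp add: eq)
  have "y \<longlonglongrightarrow> 0" "y 0 = 0" using y square_summable_tendsto_zero by (auto simp: ell2_def)
  moreover have "y n = 0" if "n \<ge> 1" for n
    using homogeneous_decay[of 1 y z r n] u hom that \<open>y \<longlonglongrightarrow> 0\<close> by (auto simp: f_def)
  ultimately show False using hom[of 0] by (simp add: f_def)
qed

text \<open>A bounded solution of the truncated equation, cut off linearly over a window of length \<open>N\<close>,
  solves the equation up to an error of size \<open>1/N\<close> on the window, which is small in \<open>\<ell>\<^sup>2\<close>.\<close>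

lemma elliptic_dense_range:
  assumes u: "u z = of_real r" "\<bar>r\<bar> < 1" and f: "f \<in> ell2" and e: "e > 0"
  shows "\<exists>y\<in>ell2. ell2_norm (\<lambda>n. f n - (jacobi_op a b y n - z * y n)) < e"
proof -
  define F where "F n = (cmod (f n))\<^sup>2" for n
  have F: "F sums suminf F" "f 0 = 0" using f by (auto simp: ell2_def F_def[abs_def] intro: summable_sums)
  have "(\<lambda>K. suminf F - (\<Sum>n<K. F n)) \<longlonglongrightarrow> suminf F - suminf F"
    using F(1) by (intro tendsto_intros) (simp add: sums_def)
  then have "eventually (\<lambda>K. suminf F - (\<Sum>n<K. F n) < e\<^sup>2 / 4) sequentially"
    using e by (intro order_tendstoD) auto
  \<comment> \<open>The tail of \<open>f\<close> past \<open>K\<close> enters the final estimate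
    with factor 2 and takes half of the allowed \<open>e\<^sup>2\<close>; the cutoff error gets the
    other half.\<close>
  then obtain K where K: "suminf F - (\<Sum>n<Suc K. F n) < e\<^sup>2 / 4"
    unfolding eventually_sequentially using le_SucI by blast
  obtain Y C where Y: "Y 0 = 0" "\<And>n. cmod (Y n) \<le> C"
    "\<And>n. n \<ge> 1 \<Longrightarrow> jacobi_op a b Y n - z * Y n = (if n \<le> K then f n else 0)"
    using bounded_truncated_solution[OF u, of K f] by blast
  define A where "A = a 0 + a 1"
  have C0: "C \<ge> 0" using Y(2)[of 0] norm_ge_zero order_trans by blast
  have A0: "A \<ge> 0" using a_pos[of 0] a_pos[of 1] by (simp add: A_def)
  \<comment> \<open>Two neighbours each contribute at most \<open>A * C / N\<close> to the cutoff
    error.\<close>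
  define c where "c = 2 * A * C"
  have "(\<lambda>N. 2 * c\<^sup>2 * ((real K + real N + 1) / (real N)\<^sup>2)) \<longlonglongrightarrow> 2 * c\<^sup>2 * 0"
    by (intro tendsto_intros) real_asymp
  then have "eventually (\<lambda>N. 2 * c\<^sup>2 * ((real K + real N + 1) / (real N)\<^sup>2) < e\<^sup>2 / 2) sequentially"
    using e by (intro order_tendstoD) auto
  then have "eventually (\<lambda>N. 2 * c\<^sup>2 * ((real K + real N + 1) / (real N)\<^sup>2) < e\<^sup>2 / 2 \<and> N > 0) sequentially"
    by (intro eventually_conj eventually_gt_at_top)
  then obtain N where N: "2 * c\<^sup>2 * ((real K + real N + 1) / (real N)\<^sup>2) < e\<^sup>2 / 2" "N > 0"
    using eventually_happens'[OF sequentially_bot] by blast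
  \<comment> \<open>Truncated subtraction makes this 1 up to \<open>K\<close>; it then falls with
    slope \<open>1 / N\<close> to 0 at \<open>K + N\<close>.\<close>
  define \<phi> where "\<phi> n = max 0 (1 - real (n - K) / real N)" for n
  have chi1: "\<phi> n = 1" if "n \<le> K" for n using that by (simp add: \<phi>_def)
  have chi0: "\<phi> n = 0" if "n \<ge> K + N" for n
    using that N(2) by (simp add: \<phi>_def max_def field_simps of_nat_diff)
  have lip: "\<bar>\<phi> (Suc n) - \<phi> n\<bar> \<le> 1 / real N" for n
  proof -
    have "\<bar>real (Suc n - K) / real N - real (n - K) / real N\<bar> \<le> 1 / real N"
      using N(2) by (cases "K \<le> n") (auto simp: of_nat_diff diff_divide_distrib[symmetric] divide_right_mono Suc_diff_le)
    moreover have "\<bar>max 0 (1 - p) - max 0 (1 - q)\<bar> \<le> \<bar>p - q\<bar>" for p q :: real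
      by (simp add: max_def abs_minus_commute)
    ultimately show ?thesis unfolding \<phi>_def by (meson order_trans)
  qed
  define y where "y n = of_real (\<phi> n) * Y n" for n
  have "summable (\<lambda>n. (cmod (y n))\<^sup>2)"
    by (rule summable_finite[of "{..K + N}"]) (use chi0 in \<open>auto simp: y_def\<close>)
  then have "y \<in> ell2" by (simp add: ell2_def y_def Y)
  define g where "g n = f n - (jacobi_op a b y n - z * y n)" for n
  \<comment> \<open>A summable majorant: the tail of \<open>f\<close> plus a constant on the window.
    Index \<open>K + N\<close> belongs to the window because its left neighbour still has a nonzero
    cutoff.\<close>
  define h where "h n = 2 * (F n - (if n \<in> {..<Suc K} then F n else 0))
      + (if n \<in> {..<K + N + 1} then 2 * (c / real N)\<^sup>2 else 0)" for n
  have bnd: "(cmod (g n))\<^sup>2 \<le> h n" for n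
  proof (cases n)
    case 0
    then show ?thesis by (simp add: g_def h_def jacobi_op_def y_def Y F(2))
  next
    case (Suc m)
    \<comment> \<open>The commutator of the cutoff with the Jacobi matrix; only differences of
      neighbouring cutoff values survive.\<close>
    define E where "E = of_real (a m * (\<phi> m - \<phi> n)) * Y m + of_real (a n * (\<phi> (Suc n) - \<phi> n)) * Y (Suc n)"
    have "jacobi_op a b y n - z * y n = of_real (\<phi> n) * (jacobi_op a b Y n - z * Y n) + E"
      by (simp add: Suc jacobi_op_def y_def E_def algebra_simps)
    also have "jacobi_op a b Y n - z * Y n = (if n \<le> K then f n else 0)" by (rule Y(3)) (simp add: Suc)
    finally have "g n = (if n \<le> K then 0 else f n) - E" using chi1[of n] by (auto simp: g_def)
    then have "cmod (g n) \<le> cmod (if n \<le> K then 0 else f n) + cmod E"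
      using norm_triangle_ineq4 by metis
    then have "(cmod (g n))\<^sup>2 \<le> (cmod (if n \<le> K then 0 else f n) + cmod E)\<^sup>2"
      by (intro power_mono) auto
    also have "\<dots> \<le> 2 * (cmod (if n \<le> K then 0 else f n))\<^sup>2 + 2 * (cmod E)\<^sup>2"
      using sum_squares_bound[of "cmod (if n \<le> K then 0 else f n)" "cmod E"] by (simp add: power2_sum)
    also have "\<dots> \<le> h n"
    proof -
      have "(cmod (if n \<le> K then 0 else f n))\<^sup>2 = F n - (if n \<in> {..<Suc K} then F n else 0)"
        by (auto simp: F_def)
      moreover have "2 * (cmod E)\<^sup>2 \<le> (if n \<in> {..<K + N + 1} then 2 * (c / real N)\<^sup>2 else 0)"
      proof (cases "n \<le> K + N")
        case True
        have t: "cmod (of_real (a k * t) * Y j) \<le> A * (1 / N) * C" if "\<bar>t\<bar> \<le> 1 / N" for k t j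
          unfolding norm_mult norm_of_real abs_mult
          using a_bound[of k] a_pos[of k] Y(2) C0 A0 that
          by (intro mult_mono) (auto simp: A_def)
        have "cmod E \<le> A * (1 / N) * C + A * (1 / N) * C"
          unfolding E_def using lip[of m] lip[of n] Suc
          by (intro norm_triangle_le add_mono t) (auto simp: abs_minus_commute)
        then have "cmod E \<le> c / N" by (simp add: c_def)
        then have "(cmod E)\<^sup>2 \<le> (c / real N)\<^sup>2" by (intro power_mono) auto
        then show ?thesis using True by simp
      next
        case False
        then have "E = 0" using chi0[of m] chi0[of n] chi0[of "Suc n"] Suc by (simp add: E_def)
        then show ?thesis by simp
      qed
      ultimately show ?thesis by (simp add: h_def)
    qed
    finally show ?thesis .
  qed
  have "h sums (2 * (suminf F - (\<Sum>n<Suc K. F n)) + (\<Sum>n<K + N + 1. 2 * (c / real N)\<^sup>2))"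
    unfolding h_def by (intro sums_add sums_mult sums_diff F(1) sums_If_finite_set) auto
  then have "(\<Sum>n. (cmod (g n))\<^sup>2) \<le> 2 * (suminf F - (\<Sum>n<Suc K. F n)) + (\<Sum>n<K + N + 1. 2 * (c / real N)\<^sup>2)"
    by (intro suminf_le_sums[OF _ bnd]) auto
  also have "(\<Sum>n<K + N + 1. 2 * (c / real N)\<^sup>2) = 2 * c\<^sup>2 * ((real K + real N + 1) / (real N)\<^sup>2)"
    by (simp add: power_divide)
  also have "2 * (suminf F - (\<Sum>n<Suc K. F n)) + 2 * c\<^sup>2 * ((real K + real N + 1) / (real N)\<^sup>2) < e\<^sup>2"
  proof -
    have "2 * S + X < e\<^sup>2" if "S < e\<^sup>2 / 4" "X < e\<^sup>2 / 2" for S X :: real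
      using that by simp
    from this[OF K N(1)] show ?thesis .
  qed
  finally have "ell2_norm g < e"
    unfolding ell2_norm_def using e by (intro real_less_lsqrt) auto
  with \<open>y \<in> ell2\<close> show ?thesis unfolding g_def by blast
qed

lemma elliptic_in_continuous_spectrum:
  assumes "u z = of_real r" "\<bar>r\<bar> < 1"
  shows "z \<in> continuous_spectrum (jacobi_op a b)"
  unfolding continuous_spectrum_def
  using elliptic_inj[OF assms] elliptic_not_surj[OF assms] elliptic_dense_range[OF assms] by blast

lemma continuous_spectrum_subset:
  assumes "z \<in> continuous_spectrum (jacobi_op a b)"
  obtains r where "\<bar>r\<bar> \<le> 1" "u z = of_real r"
  using assms joukowski_root_exists[of "u z"] hyperbolic_not_in_continuous_spectrum by metis

end

section \<open>Matrix entries from the band edges\<close>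

text \<open>Both outer ends of the first set are at distance at most \<open>d\<close> from 0, while
  \<open>d\<close> and \<open>- d\<close> lie within \<open>r2\<close> of \<open>c\<close>; this
  forces \<open>c = 0\<close>. Density of the reals supplies the endpoints missing from
  \<open>inside\<close>.\<close>

lemma symmetric_annulus:
  fixes c r s d :: real
  assumes r: "r1 < r2" and r1: "0 \<le> r1" and sd: "0 < s" "s < d"
    and inside: "\<And>x. r1 < \<bar>x - c\<bar> \<Longrightarrow> \<bar>x - c\<bar> < r2 \<Longrightarrow> s \<le> \<bar>x\<bar> \<and> \<bar>x\<bar> \<le> d"
    and outside: "\<And>x. s \<le> \<bar>x\<bar> \<Longrightarrow> \<bar>x\<bar> \<le> d \<Longrightarrow> r1 \<le> \<bar>x - c\<bar> \<and> \<bar>x - c\<bar> \<le> r2"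
  shows "c = 0" "r1 = s" "r2 = d"
proof -
  have "c + r2 \<le> d"
  proof (rule dense_le_bounded[of "c + r1"])
    fix w assume "c + r1 < w" "w < c + r2"
    then show "w \<le> d" using inside[of w] r1 by auto
  qed (use r in simp)
  moreover have "r2 - c \<le> d"
  proof (rule dense_le_bounded[of "r1 - c"])
    fix w assume "r1 - c < w" "w < r2 - c"
    then show "w \<le> d" using inside[of "- w"] r1 by auto
  qed (use r in simp)
  ultimately show c: "c = 0" and r2: "r2 = d" using outside[of d] outside[of "- d"] sd by auto
  have "s \<le> r1"
  proof (rule dense_ge_bounded[of r1 r2])
    fix w assume "r1 < w" "w < r2"
    then show "s \<le> w" using inside[of w] r1 c by auto
  qed (rule r)
  with outside[of s] c sd show "r1 = s" by auto
qed

context periodic_jacobi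
begin

lemma band_edges:
  assumes sd: "0 < s" "s < d"
    and spec: "continuous_spectrum (jacobi_op a b) = of_real ` ({-d..-s} \<union> {s..d})"
  shows "b 2 = - b 1" "s\<^sup>2 = (b 1)\<^sup>2 + (a 1 - a 0)\<^sup>2" "d\<^sup>2 = (b 1)\<^sup>2 + (a 1 + a 0)\<^sup>2"
proof -
  \<comment> \<open>Completing the square: \<open>U\<close> is increasing in the distance to the
    midpoint \<open>c\<close> and takes the values -1 and 1 at distances \<open>r1\<close> and
    \<open>r2\<close>.\<close>
  define c h where "c = (b 1 + b 2) / 2" and "h = (b 1 - b 2) / 2"
  define r1 r2 where "r1 = sqrt (h\<^sup>2 + (a 1 - a 0)\<^sup>2)" and "r2 = sqrt (h\<^sup>2 + (a 1 + a 0)\<^sup>2)"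
  have pos: "a 0 * a 1 > 0" using a_pos by simp
  define U where "U x = ((x - c)\<^sup>2 - h\<^sup>2 - (a 1)\<^sup>2 - (a 0)\<^sup>2) / (2 * a 0 * a 1)" for x
  have u: "u (of_real x) = of_real (U x)" for x
    unfolding u_eq U_def c_def h_def by (simp add: field_simps power2_eq_square)
  have edge: "-1 \<le> U x \<longleftrightarrow> r1 \<le> \<bar>x - c\<bar>" "-1 < U x \<longleftrightarrow> r1 < \<bar>x - c\<bar>"
    "U x \<le> 1 \<longleftrightarrow> \<bar>x - c\<bar> \<le> r2" "U x < 1 \<longleftrightarrow> \<bar>x - c\<bar> < r2" for x
    using pos unfolding real_sqrt_abs[of "x - c", symmetric] r1_def r2_def real_sqrt_le_iff real_sqrt_less_iff
    by (simp_all add: U_def field_simps power2_eq_square)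
  have mem: "of_real x \<in> (of_real ` ({-d..-s} \<union> {s..d}) :: complex set) \<longleftrightarrow> s \<le> \<bar>x\<bar> \<and> \<bar>x\<bar> \<le> d" for x
    using sd by (auto simp: image_iff)
  have inside: "s \<le> \<bar>x\<bar> \<and> \<bar>x\<bar> \<le> d" if "r1 < \<bar>x - c\<bar>" "\<bar>x - c\<bar> < r2" for x
    using elliptic_in_continuous_spectrum[OF u, of x] that
    unfolding edge[symmetric] spec mem by auto
  have outside: "r1 \<le> \<bar>x - c\<bar> \<and> \<bar>x - c\<bar> \<le> r2" if "s \<le> \<bar>x\<bar>" "\<bar>x\<bar> \<le> d" for x
  proof -
    have "of_real x \<in> continuous_spectrum (jacobi_op a b)" using that unfolding spec mem by simp
    then obtain r where "\<bar>r\<bar> \<le> 1" "u (of_real x) = of_real r" by (rule continuous_spectrum_subset)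
    then show ?thesis unfolding edge[symmetric] u by auto
  qed
  have "r1 < r2" using pos by (simp add: r1_def r2_def power2_eq_square algebra_simps)
  moreover have "0 \<le> r1" by (simp add: r1_def)
  ultimately have res: "c = 0" "r1 = s" "r2 = d"
    using symmetric_annulus[of r1 r2 s d c] sd inside outside by blast+
  show b2: "b 2 = - b 1" using res(1) by (simp add: c_def)
  show "s\<^sup>2 = (b 1)\<^sup>2 + (a 1 - a 0)\<^sup>2" "d\<^sup>2 = (b 1)\<^sup>2 + (a 1 + a 0)\<^sup>2"
    unfolding res(2,3)[symmetric] r1_def r2_def by (simp_all add: h_def b2)
qed

end

section \<open>The Weyl function of a two-band matrix\<close>

text \<open>Makes limits from the chosen half-plane unique.\<close>

lemma half_plane_nontrivial:
  assumes "\<sigma> = 1 \<or> \<sigma> = (-1 :: real)"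
  shows "at (complex_of_real x) within {z. 0 < \<sigma> * Im z} \<noteq> bot"
proof -
  have "complex_of_real x islimpt {z. 0 < \<sigma> * Im z}"
    unfolding islimpt_approachable
  proof (intro allI impI)
    fix e :: real assume "e > 0"
    then have "Complex x (\<sigma> * (e / 2)) \<in> {z. 0 < \<sigma> * Im z}" "Complex x (\<sigma> * (e / 2)) \<noteq> of_real x"
      "dist (Complex x (\<sigma> * (e / 2))) (of_real x) < e"
      using assms by (auto simp: complex_eq_iff dist_norm cmod_def)
    then show "\<exists>x'\<in>{z. 0 < \<sigma> * Im z}. x' \<noteq> complex_of_real x \<and> dist x' (complex_of_real x) < e" by blast
  qed
  then show ?thesis by (simp add: trivial_limit_within)
qed

lemma boundary_values_continuous:
  fixes w :: "complex \<Rightarrow> complex"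
  assumes side: "\<sigma> = 1 \<or> \<sigma> = (-1 :: real)"
    and lim: "\<And>x. \<bar>x\<bar> < s \<Longrightarrow> (w \<longlongrightarrow> w (of_real x)) (at (of_real x) within {z. 0 < \<sigma> * Im z})"
    and x0: "\<bar>x0\<bar> < s"
  shows "(w \<longlongrightarrow> w (of_real x0)) (at (of_real x0) within {z. 0 \<le> \<sigma> * Im z})"
  unfolding Lim_within
proof (intro allI impI)
  fix e :: real assume e: "e > 0"
  with lim[OF x0, unfolded Lim_within, rule_format, of "e / 2"] obtain \<delta>
    where \<delta>: "\<delta> > 0" "\<And>z. 0 < \<sigma> * Im z \<Longrightarrow> 0 < dist z x0 \<Longrightarrow> dist z x0 < \<delta> \<Longrightarrow> dist (w z) (w x0) < e / 2"
    by auto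
  have "dist (w z) (w x0) < e"
    if z: "0 \<le> \<sigma> * Im z" "0 < dist z x0" "dist z x0 < min \<delta> (s - \<bar>x0\<bar>)" for z
  proof (cases "Im z = 0")
    case False
    then have "0 < \<sigma> * Im z" using z(1) side by auto
    then show ?thesis using \<delta>(2)[of z] z e by auto
  next
    case True
    then have zx: "z = of_real (Re z)" by (simp add: complex_eq_iff)
    have "dist z x0 = \<bar>Re z - x0\<bar>" by (subst zx) (simp add: dist_norm flip: of_real_diff)
    then have "\<bar>Re z\<bar> < s" using z(3) by linarith
    then have "(w \<longlongrightarrow> w z) (at z within {z. 0 < \<sigma> * Im z})" using lim[of "Re z"] zx by simp
    then have "((\<lambda>y. dist (w y) (w x0)) \<longlongrightarrow> dist (w z) (w x0)) (at z within {z. 0 < \<sigma> * Im z})"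
      by (intro tendsto_intros)
    moreover have "eventually (\<lambda>y. dist (w y) (w x0) \<le> e / 2) (at z within {z. 0 < \<sigma> * Im z})"
    proof -
      have "eventually (\<lambda>y. y \<in> ball (of_real x0) \<delta>) (nhds z)"
        using z(3) by (intro eventually_nhds_in_open) (auto simp: dist_commute)
      then have "eventually (\<lambda>y. y \<in> ball (of_real x0) \<delta>) (at z within {z. 0 < \<sigma> * Im z})"
        by (rule filter_leD[OF at_within_le_nhds])
      moreover have "eventually (\<lambda>y. y \<in> {z. 0 < \<sigma> * Im z}) (at z within {z. 0 < \<sigma> * Im z})"
        by (simp add: eventually_at_filter)
      ultimately show ?thesis
      proof eventually_elim
        case (elim y)
        then have "y \<noteq> of_real x0" by auto
        then show ?case using \<delta>(2)[of y] elim by (auto simp: dist_commute)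
      qed
    qed
    moreover have "at z within {z. 0 < \<sigma> * Im z} \<noteq> bot"
      using half_plane_nontrivial[OF side, of "Re z"] zx by simp
    ultimately have "dist (w z) (w x0) \<le> e / 2" by (rule tendsto_upperbound)
    then show ?thesis using e by simp
  qed
  then show "\<exists>\<delta>>0. \<forall>z\<in>{z :: complex. 0 \<le> \<sigma> * Im z}.
      0 < dist z (of_real x0) \<and> dist z (of_real x0) < \<delta> \<longrightarrow> dist (w z) (w (of_real x0)) < e"
    using \<delta>(1) x0 by (intro exI[of _ "min \<delta> (s - \<bar>x0\<bar>)"]) auto
qed

text \<open>The difference factors as (x - y)(xy - 1)/(xy), and |xy| is at most |y|. This one
  estimate gives both uniqueness of the root and continuity of \<open>w2_fun\<close>.\<close>

lemma joukowski_diff: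
  fixes x y :: complex
  assumes "x \<noteq> 0" "y \<noteq> 0" "cmod x < 1" "cmod y < 1"
  shows "(1 - cmod y) * cmod (x - y) \<le> cmod ((x + inverse x) - (y + inverse y))"
proof -
  have xy: "cmod (x * y) \<le> cmod y" "cmod (x * y) > 0"
    using assms mult_right_mono[of "cmod x" 1 "cmod y"] by (auto simp: norm_mult)
  have "(x + inverse x) - (y + inverse y) = (x - y) * (x * y - 1) / (x * y)"
    using assms by (simp add: field_simps)
  then have eq: "cmod ((x + inverse x) - (y + inverse y)) = cmod (x - y) * cmod (x * y - 1) / cmod (x * y)"
    by (simp only: norm_mult norm_divide)
  have "1 - cmod y \<le> cmod (x * y - 1)"
    using norm_triangle_ineq2[of 1 "x * y"] xy by (simp add: norm_minus_commute)
  then have "(1 - cmod y) * cmod (x - y) \<le> cmod (x * y - 1) * cmod (x - y)"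
    by (intro mult_right_mono) auto
  also have "\<dots> \<le> cmod (x - y) * cmod (x * y - 1) / cmod (x * y)"
  proof -
    have "cmod (x * y) \<le> 1" using xy(1) assms(4) by linarith
    then have "(cmod (x - y) * cmod (x * y - 1)) * cmod (x * y) \<le> cmod (x - y) * cmod (x * y - 1)"
      by (intro mult_left_le) auto
    then show ?thesis
      unfolding pos_le_divide_eq[OF xy(2)] by (simp only: mult.commute[of "cmod (x * y - 1)"])
  qed
  finally show ?thesis unfolding eq .
qed

text \<open>The spectral assumption is replaced by its algebraic consequences from
  \<open>band_edges\<close>.\<close>

locale two_band_jacobi = periodic_jacobi +
  fixes s d :: real
  assumes s_pos: "0 < s" and s_less_d: "s < d" and b_2: "b 2 = - b 1" and nu: "\<bar>b 1\<bar> < s"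
    and s_sq: "s\<^sup>2 = (b 1)\<^sup>2 + (a 1 - a 0)\<^sup>2" and d_sq: "d\<^sup>2 = (b 1)\<^sup>2 + (a 1 + a 0)\<^sup>2"
begin

definition bands :: "complex set" where "bands = of_real ` ({-d..-s} \<union> {s..d})"

abbreviation w2 where "w2 \<equiv> w2_fun a b"

text \<open>Equality would give s = |\<nu>|. Hence comparing \<open>a 0\<close> with
  \<open>a 1\<close> leaves exactly two cases, which are the two values of
  \<open>eps\<close>.\<close>

lemma a_neq: "a 0 \<noteq> a 1"
proof
  assume "a 0 = a 1"
  then have "s\<^sup>2 = (b 1)\<^sup>2" using s_sq by simp
  then have "\<bar>s\<bar> = \<bar>b 1\<bar>" by (simp add: power2_eq_iff abs_eq_iff)
  then show False using nu s_pos by simp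
qed

lemma gap: "d\<^sup>2 - s\<^sup>2 = 4 * a 0 * a 1"
  unfolding s_sq d_sq by (simp add: power2_eq_square algebra_simps)

lemma u_gap:
  fixes z :: complex
  shows "2 * u z * a 0 * a 1 = z\<^sup>2 - (b 1)\<^sup>2 - (a 1)\<^sup>2 - (a 0)\<^sup>2"
  using u_mult[of z] by (simp add: b_2 power2_eq_square algebra_simps)

lemma of_real_in_bands: "of_real x \<in> bands \<longleftrightarrow> s \<le> \<bar>x\<bar> \<and> \<bar>x\<bar> \<le> d"
  using s_pos s_less_d by (auto simp: bands_def image_iff)

text \<open>\<open>z\<^sup>2\<close> is an affine function of \<open>u z\<close> that maps [-1, 1]
  onto the interval from \<open>s\<^sup>2\<close> to \<open>d\<^sup>2\<close>.\<close>

lemma u_off_bands: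
  fixes z :: complex
  assumes "z \<notin> bands" "\<bar>r\<bar> \<le> 1"
  shows "u z \<noteq> of_real r"
proof
  assume u: "u z = of_real r"
  define t where "t = 2 * r * a 0 * a 1 + (b 1)\<^sup>2 + (a 1)\<^sup>2 + (a 0)\<^sup>2"
  have pos: "a 0 * a 1 > 0" using a_pos by simp
  have "\<bar>r * (a 0 * a 1)\<bar> \<le> a 0 * a 1"
    using pos assms(2) mult_right_mono[of "\<bar>r\<bar>" 1 "a 0 * a 1"]
    unfolding abs_mult[of r] abs_of_pos[OF pos] by simp
  then have t: "s\<^sup>2 \<le> t" "t \<le> d\<^sup>2"
    unfolding s_sq d_sq t_def by (auto simp: power2_eq_square algebra_simps abs_le_iff)
  have t0: "t \<ge> 0" using t(1) by (meson order_trans zero_le_power2)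
  have "z\<^sup>2 = of_real t" using u_gap[of z] unfolding u t_def by (simp add: algebra_simps)
  also have "\<dots> = (of_real (sqrt t))\<^sup>2" using t0 by (simp flip: of_real_power)
  finally have "z = of_real (sqrt t) \<or> z = of_real (- sqrt t)" by (simp add: power2_eq_iff)
  moreover have "s \<le> sqrt t" "sqrt t \<le> d"
    using t s_pos s_less_d by (auto intro: real_le_rsqrt real_le_lsqrt)
  ultimately have "z \<in> bands" using of_real_in_bands s_pos by fastforce
  then show False using assms by simp
qed

lemma w2_eqI:
  fixes z :: complex
  assumes "x \<noteq> 0" "cmod x < 1" "x + inverse x = 2 * u z"
  shows "w2 z = x"
  unfolding w2_fun_def
proof (rule the_equality)
  fix y assume y: "y \<noteq> 0 \<and> cmod y < 1 \<and> y + inverse y = 2 * u z"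
  then have "(1 - cmod x) * cmod (y - x) \<le> 0" using joukowski_diff[of y x] assms by simp
  then show "y = x" using assms(2) by (simp add: mult_le_0_iff)
qed (use assms in auto)

lemma w2:
  fixes z :: complex
  assumes "z \<notin> bands"
  shows "w2 z \<noteq> 0" "cmod (w2 z) < 1" "w2 z + inverse (w2 z) = 2 * u z"
proof -
  obtain \<zeta> where \<zeta>: "\<zeta> \<noteq> 0" "cmod \<zeta> < 1" "\<zeta> + inverse \<zeta> = 2 * u z"
    using joukowski_root_exists[of "u z"] u_off_bands[OF assms] by blast
  then show "w2 z \<noteq> 0" "cmod (w2 z) < 1" "w2 z + inverse (w2 z) = 2 * u z"
    using w2_eqI by auto
qed

lemma open_off_bands: "open (- bands)"
  unfolding bands_def
  by (intro open_Compl compact_imp_closed compact_continuous_image continuous_intros compact_Un) auto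

lemma eventually_off_bands: "z0 \<notin> bands \<Longrightarrow> \<forall>\<^sub>F z in at z0. z \<notin> bands"
  using eventually_at_in_open'[OF open_off_bands, of z0] by simp

lemma tendsto_w2:
  fixes z0 :: complex
  assumes z0: "z0 \<notin> bands"
  shows "w2 \<midarrow>z0\<rightarrow> w2 z0"
proof (rule LIM_zero_cancel, rule Lim_null_comparison)
  show "\<forall>\<^sub>F z in at z0. norm (w2 z - w2 z0) \<le> cmod (2 * u z - 2 * u z0) / (1 - cmod (w2 z0))"
    using eventually_off_bands[OF z0]
  proof eventually_elim
    case (elim z)
    have "(1 - cmod (w2 z0)) * cmod (w2 z - w2 z0) \<le> cmod (2 * u z - 2 * u z0)"
      using joukowski_diff[of "w2 z" "w2 z0"] w2(1,2)[OF elim] w2(1,2)[OF z0]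
      unfolding w2(3)[OF elim] w2(3)[OF z0] by blast
    then show ?case using w2(2)[OF z0] by (simp add: pos_le_divide_eq mult.commute)
  qed
  have "((\<lambda>z. cmod (2 * u z - 2 * u z0) / (1 - cmod (w2 z0))) \<longlongrightarrow>
      cmod (2 * u z0 - 2 * u z0) / (1 - cmod (w2 z0))) (at z0)"
    unfolding u_eq using w2(2)[OF z0] by (intro tendsto_intros) auto
  then show "((\<lambda>z. cmod (2 * u z - 2 * u z0) / (1 - cmod (w2 z0))) \<longlongrightarrow> 0) (at z0)" by simp
qed

text \<open>The quadratic equation for \<open>w2 z\<close>, multiplied by \<open>a 0 * a 1\<close>
  and regrouped. It links the numerator of the Weyl function to the denominator of the claimed
  formula.\<close>

lemma w2_factorization:
  fixes z :: complex
  assumes "z \<notin> bands"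
  shows "(a 1 * w2 z + a 0) * (a 0 * w2 z + a 1) = w2 z * (z + b 1) * (z - b 1)"
proof -
  have "w2 z * w2 z + 1 = 2 * u z * w2 z"
    using w2[OF assms] by (metis distrib_right left_inverse)
  then show ?thesis using u_gap[of z] unfolding of_real_power by algebra
qed

lemma nu_off_bands: "of_real (b 1) \<notin> bands"
  using nu by (simp add: of_real_in_bands)

text \<open>At \<nu> the two reciprocal roots are -a0/a1 and -a1/a0; the modulus selects
  one.\<close>

lemma w2_nu: "w2 (b 1) = (if a 0 < a 1 then - (a 0 / a 1) else - (a 1 / a 0))"
proof (rule w2_eqI)
  have "2 * u (b 1) = (- (a 1)\<^sup>2 - (a 0)\<^sup>2) / (a 0 * a 1)"
    using u_gap[of "b 1"] by (simp add: eq_divide_eq mult.assoc)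
  also have "\<dots> = - (a 0 / a 1) - (a 1 / a 0)"
    by (simp add: field_simps power2_eq_square)
  finally show "complex_of_real (if a 0 < a 1 then - (a 0 / a 1) else - (a 1 / a 0)) +
    inverse (complex_of_real (if a 0 < a 1 then - (a 0 / a 1) else - (a 1 / a 0))) = 2 * u (b 1)"
    by simp
qed (use a_pos[of 0] a_pos[of 1] a_neq in \<open>auto simp: norm_divide\<close>)

text \<open>\<open>v - root_fun\<close> equals \<open>w2 z\<close> minus
  \<open>cos_sol a b 2 z\<close>, and the latter is -a0/a1.\<close>

lemma weyl_quotient:
  fixes z :: complex
  shows "(v_fun a b z - root_fun a b z) / sin_sol a b 2 z = (a 1 * w2 z + a 0) / (z - b 1)"
proof -
  have "v_fun a b z - root_fun a b z = w2 z + a 0 / a 1"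
    unfolding root_fun_def u_fun_def v_fun_def cos_sol_2 by (simp add: field_simps)
  then show ?thesis unfolding sin_sol_2 by (simp add: field_simps)
qed

lemma tendsto_weyl_quotient:
  fixes z0 :: complex
  assumes "z0 \<notin> bands" "z0 \<noteq> b 1"
  shows "(\<lambda>z::complex. (a 1 * w2 z + a 0) / (z - b 1)) \<midarrow>z0\<rightarrow> (a 1 * w2 z0 + a 0) / (z0 - b 1)"
  using assms by (intro tendsto_intros tendsto_w2) auto

lemma weyl_m_eq:
  fixes z :: complex
  assumes "z \<notin> bands" "z \<noteq> b 1"
  shows "weyl_m a b z = (a 1 * w2 z + a 0) / (z - b 1)"
  unfolding weyl_m_def weyl_quotient
  by (rule remove_sings_eqI[OF tendsto_weyl_quotient[OF assms]])

lemma eventually_weyl_m_eq: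
  fixes z0 :: complex
  assumes "z0 \<notin> bands"
  shows "\<forall>\<^sub>F z in at z0. weyl_m a b z = (a 1 * w2 z + a 0) / (z - b 1)"
proof -
  have "\<forall>\<^sub>F z in at z0. z \<noteq> b 1" by (rule eventually_neq_at_within)
  with eventually_off_bands[OF assms] show ?thesis by eventually_elim (simp add: weyl_m_eq)
qed

lemma tendsto_weyl_m:
  fixes z0 :: complex
  assumes "z0 \<notin> bands" "z0 \<noteq> b 1"
  shows "weyl_m a b \<midarrow>z0\<rightarrow> weyl_m a b z0"
  using tendsto_weyl_quotient[OF assms] unfolding weyl_m_eq[OF assms]
  by (rule Lim_transform_eventually) (use eventually_weyl_m_eq[OF assms(1)] in \<open>simp add: eq_commute\<close>)

lemma denominator_nonzero:
  assumes "z \<notin> bands" "a 0 < a 1"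
  shows "a 0 * w2 z + a 1 \<noteq> 0"
proof
  assume "a 0 * w2 z + a 1 = 0"
  then have "a 0 * w2 z = - of_real (a 1)" by algebra
  then have "cmod (a 0 * w2 z) = cmod (- of_real (a 1))" by (rule arg_cong)
  then have "a 0 * cmod (w2 z) = a 1" using a_pos[of 0] a_pos[of 1] by (simp add: norm_mult)
  moreover have "a 0 * cmod (w2 z) < a 0 * 1"
    using a_pos[of 0] w2(2)[OF assms(1)] by (intro mult_strict_left_mono) auto
  ultimately show False using assms(2) by simp
qed

text \<open>Here the numerator vanishes at \<nu> too. The factorization trades the quotient for one
  with a nonzero denominator, whose limit is the value supplied by
  \<open>remove_sings\<close>.\<close>

lemma weyl_m_removable:
  assumes "a 0 < a 1"
  shows "weyl_m a b (b 1) = 2 * b 1 * w2 (b 1) / (a 0 * w2 (b 1) + a 1)"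
    and "weyl_m a b \<midarrow>complex_of_real (b 1)\<rightarrow> weyl_m a b (b 1)"
proof -
  have "(\<lambda>z::complex. (z + b 1) * w2 z / (a 0 * w2 z + a 1)) \<midarrow>complex_of_real (b 1)\<rightarrow>
      (complex_of_real (b 1) + complex_of_real (b 1)) * w2 (b 1) / (a 0 * w2 (b 1) + a 1)"
    using denominator_nonzero[OF nu_off_bands assms]
    by (intro tendsto_intros tendsto_w2 nu_off_bands)
  moreover have "\<forall>\<^sub>F z in at (complex_of_real (b 1)).
      (z + b 1) * w2 z / (a 0 * w2 z + a 1) = (a 1 * w2 z + a 0) / (z - b 1)"
  proof -
    have "\<forall>\<^sub>F z in at (complex_of_real (b 1)). z \<noteq> b 1" by (rule eventually_neq_at_within)
    with eventually_off_bands[OF nu_off_bands] show ?thesis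
    proof eventually_elim
      case (elim z)
      then show ?case using w2_factorization[of z] denominator_nonzero[of z] assms
        by (simp add: frac_eq_eq mult.commute mult.left_commute)
    qed
  qed
  ultimately have lim: "(\<lambda>z::complex. (a 1 * w2 z + a 0) / (z - b 1)) \<midarrow>complex_of_real (b 1)\<rightarrow>
      2 * b 1 * w2 (b 1) / (a 0 * w2 (b 1) + a 1)"
    unfolding mult_2 of_real_add by (rule Lim_transform_eventually)
  then show eq: "weyl_m a b (b 1) = 2 * b 1 * w2 (b 1) / (a 0 * w2 (b 1) + a 1)"
    unfolding weyl_m_def weyl_quotient by (rule remove_sings_eqI)
  show "weyl_m a b \<midarrow>complex_of_real (b 1)\<rightarrow> weyl_m a b (b 1)" unfolding eq
    using lim by (rule Lim_transform_eventually)
      (use eventually_weyl_m_eq[OF nu_off_bands] in \<open>simp add: eq_commute\<close>)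
qed

text \<open>In this case the numerator at \<nu> is a0 - a1^2/a0, which is nonzero.\<close>

lemma weyl_m_pole:
  assumes "a 1 < a 0"
  shows "is_pole (weyl_m a b) (b 1)"
proof -
  have "(\<lambda>z::complex. a 1 * w2 z + a 0) \<midarrow>complex_of_real (b 1)\<rightarrow> a 1 * w2 (b 1) + a 0"
    by (intro tendsto_intros tendsto_w2 nu_off_bands)
  moreover have "a 1 * w2 (b 1) + a 0 \<noteq> 0"
  proof -
    have "a 1 * a 1 < a 0 * a 0" using assms a_pos[of 1] by (intro mult_strict_mono) auto
    then have "a 0 - a 1 * (a 1 / a 0) \<noteq> 0" using a_pos[of 0] by (simp add: field_simps)
    then have "complex_of_real (a 0 - a 1 * (a 1 / a 0)) \<noteq> 0" by (simp only: of_real_eq_0_iff not_False_eq_True)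
    then show ?thesis using assms unfolding w2_nu by simp
  qed
  moreover have "filterlim (\<lambda>z::complex. z - b 1) (at 0) (at (complex_of_real (b 1)))"
    by (intro filterlim_atI) (auto intro!: tendsto_eq_intros simp: eventually_at_filter)
  ultimately have "filterlim (\<lambda>z::complex. (a 1 * w2 z + a 0) / (z - b 1)) at_infinity (at (complex_of_real (b 1)))"
    by (intro filterlim_divide_at_infinity)
  then show ?thesis unfolding is_pole_def
    using filterlim_cong[OF refl refl eventually_weyl_m_eq[OF nu_off_bands]] by blast
qed

lemma eps_eq: "eps a b = (if a 0 < a 1 then -1 else 1)"
proof (cases "a 0 < a 1")
  case True
  have "\<not> is_pole (weyl_m a b) (b 1)"
    using weyl_m_removable(2)[OF True] not_tendsto_and_filterlim_at_infinity[OF at_neq_bot]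
    unfolding is_pole_def by blast
  then show ?thesis using True by (simp add: eps_def)
next
  case False
  then show ?thesis using weyl_m_pole a_neq by (simp add: eps_def)
qed

text \<open>The exponent is -1 exactly when the root is -a0/a1, so both cases give the same
  value.\<close>

lemma w2_nu_powi_eps: "w2 (b 1) powi eps a b = - (a 1 / a 0)"
  unfolding w2_nu eps_eq by (simp add: power_int_minus)

text \<open>The factor z - \<nu> is cancelled, so the removable point is covered by the same
  formula.\<close>

lemma weyl_m_product_form:
  fixes z :: complex
  assumes "z \<notin> bands" "eps a b = 1 \<longrightarrow> z \<noteq> b 1" "a 0 * w2 z + a 1 \<noteq> 0"
  shows "weyl_m a b z = (z + b 1) * w2 z / (a 0 * w2 z + a 1)"
proof (cases "z = b 1")
  case True
  then have "a 0 < a 1" using assms(2) by (simp add: eps_eq split: if_splits)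
  show ?thesis unfolding True weyl_m_removable(1)[OF \<open>a 0 < a 1\<close>] by simp
next
  case False
  have "(a 1 * w2 z + a 0) * (a 0 * w2 z + a 1) = (z + b 1) * w2 z * (z - b 1)"
    using w2_factorization[OF assms(1)] by (simp only: mult.commute[of "w2 z"])
  then show ?thesis
    unfolding weyl_m_eq[OF assms(1) False] using assms(3) False by (subst frac_eq_eq) auto
qed

text \<open>On the gap the identity passes to the limit from the half-plane, since \<open>w2\<close>
  is continuous across the gap.\<close>

lemma w_branch_square:
  assumes side: "\<sigma> = 1 \<or> \<sigma> = -1" and w: "is_w_branch a b s d \<sigma> w" and z: "z \<notin> bands"
  shows "(w z)\<^sup>2 = w2 z"
proof (cases "z \<in> of_real ` {-d..d}")
  case False
  then show ?thesis using w by (simp add: is_w_branch_def)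
next
  case True
  then obtain x where x: "z = of_real x" "\<bar>x\<bar> \<le> d" by auto
  let ?F = "at z within {z. 0 < \<sigma> * Im z}"
  have "\<bar>x\<bar> < s" using z x of_real_in_bands by force
  then have "(w \<longlongrightarrow> w z) ?F" using w x(1) by (auto simp: is_w_branch_def abs_less_iff)
  then have "((\<lambda>y. (w y)\<^sup>2) \<longlongrightarrow> (w z)\<^sup>2) ?F" by (intro tendsto_intros)
  moreover have "\<forall>\<^sub>F y in ?F. (w y)\<^sup>2 = w2 y"
  proof -
    have "y \<notin> of_real ` {-d..d}" if "0 < \<sigma> * Im y" for y using that by auto
    then show ?thesis
      unfolding eventually_at_filter using w by (simp add: is_w_branch_def)
  qed
  ultimately have "(w2 \<longlongrightarrow> (w z)\<^sup>2) ?F" by (rule Lim_transform_eventually)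
  moreover have "(w2 \<longlongrightarrow> w2 z) ?F" using tendsto_w2[OF z] by (rule tendsto_within_subset) simp
  ultimately show ?thesis using tendsto_unique half_plane_nontrivial[OF side, of x] x(1) by blast
qed

end

section \<open>The formula for chi_1 and its limit at -\<nu>\<close>

theorem lemma4p3:
  fixes a b :: "nat \<Rightarrow> real" and s d \<nu> \<sigma> :: real and w :: "complex \<Rightarrow> complex"
    and den rhs :: "complex \<Rightarrow> complex" and bands :: "complex set"
  defines "bands \<equiv> of_real ` ({-d..-s} \<union> {s..d})"
    and "\<nu> \<equiv> b 1"
    and "den \<equiv> (\<lambda>z. w2_fun a b z - (w2_fun a b (of_real \<nu>)) powi (eps a b))"
    and "rhs \<equiv> (\<lambda>z. 4 * of_real (a 1) * (z + of_real \<nu>) * w z / of_real (d\<^sup>2 - s\<^sup>2) * (1 / den z))"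
  assumes a_pos: "\<And>n. a n > 0"
    and a_per: "\<And>n. a (n + 2) = a n"
    and b_per: "\<And>n. n \<ge> 1 \<Longrightarrow> b (n + 2) = b n"
    and sd: "0 < s" "s < d"
    and spec: "continuous_spectrum (jacobi_op a b) = bands"
    and nu: "\<bar>\<nu>\<bar> < s"
    and side: "\<sigma> = 1 \<or> \<sigma> = -1"
    and w: "is_w_branch a b s d \<sigma> w"
  shows "\<forall>z. z \<notin> bands \<and> (eps a b = 1 \<longrightarrow> z \<noteq> of_real \<nu>) \<longrightarrow>
           (den z \<noteq> 0 \<longrightarrow> chi1 a b w z = rhs z) \<and>
           (den z = 0 \<longrightarrow>
              z = - of_real \<nu> \<and> eps a b = 1 \<and>
              (rhs \<longlongrightarrow> chi1 a b w z) (at z within {\<zeta>. 0 \<le> \<sigma> * Im \<zeta>}))"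
proof -
  interpret P: periodic_jacobi a b
    using a_pos a_per b_per by unfold_locales
  interpret T: two_band_jacobi a b s d
    using P.band_edges[OF sd spec[unfolded bands_def]] sd nu
    by unfold_locales (simp_all add: \<nu>_def)
  have off: "T.bands = bands" by (simp add: bands_def T.bands_def)
  note open_off = T.eventually_off_bands[unfolded off]
  note w2 = T.w2[unfolded off] and fact = T.w2_factorization[unfolded off]
  have den: "den z = (a 0 * w2_fun a b z + a 1) / a 0" for z
    unfolding den_def \<nu>_def T.w2_nu_powi_eps using P.a_nz[of 0] by (simp add: field_simps)
  have chi1: "chi1 a b w z = weyl_m a b z / w z" for z
    by (simp add: chi1_def weyl_sol_def cos_sol_def sin_sol_def field_simps)
  have w_sq: "w z * w z = w2_fun a b z" and w_nz: "w z \<noteq> 0" if "z \<notin> bands" for z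
    using T.w_branch_square[OF side w, of z] w2(1)[of z] that by (auto simp: off power2_eq_square)
  have main: "chi1 a b w z = rhs z"
    if z: "z \<notin> bands" "eps a b = 1 \<longrightarrow> z \<noteq> of_real \<nu>" "den z \<noteq> 0" for z
  proof -
    have D: "a 0 * w2_fun a b z + a 1 \<noteq> 0" using z(3) unfolding den by auto
    \<comment> \<open>Writing \<open>w2_fun\<close> as a square of \<open>w\<close> lets one factor
      cancel against the prefactor of \<open>chi1\<close>.\<close>
    have "chi1 a b w z = (z + \<nu>) * (w z * w z) / (a 0 * w2_fun a b z + a 1) / w z"
      unfolding chi1 w_sq[OF z(1)] \<nu>_def
      using T.weyl_m_product_form[of z] z D by (simp add: off \<nu>_def)
    also have "\<dots> = (z + \<nu>) * w z / (a 0 * w2_fun a b z + a 1)"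
      using w_nz[OF z(1)] by simp
    \<comment> \<open>Since d^2 - s^2 = 4 a0 a1, the constant in \<open>rhs\<close> is 1/a0, which
      cancels the a0 from \<open>den\<close>.\<close>
    also have "\<dots> = rhs z"
      unfolding rhs_def T.gap den by simp
    finally show ?thesis .
  qed
  have degenerate: "z = - of_real \<nu> \<and> eps a b = 1 \<and>
      (rhs \<longlongrightarrow> chi1 a b w z) (at z within {\<zeta>. 0 \<le> \<sigma> * Im \<zeta>})"
    if z: "z \<notin> bands" "eps a b = 1 \<longrightarrow> z \<noteq> of_real \<nu>" and d0: "den z = 0" for z
  proof -
    have D: "a 0 * w2_fun a b z + a 1 = 0" using d0 P.a_nz[of 0] unfolding den by simp
    then have eps: "eps a b = 1"
      using T.denominator_nonzero[of z] z(1) unfolding T.eps_eq off by auto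
    then have z_nu: "z \<noteq> of_real \<nu>" using z by simp
    \<comment> \<open>The left side of the factorization is 0 and \<open>w2_fun\<close> is not, so z
      is \<nu> or -\<nu>.\<close>
    have zn: "z = - of_real \<nu>"
      using fact[OF z(1)] D w2(1)[OF z(1)] z_nu unfolding \<nu>_def by (simp add: eq_neg_iff_add_eq_0)
    let ?F = "at z within {\<zeta>. 0 \<le> \<sigma> * Im \<zeta>}"
    have "(weyl_m a b \<longlongrightarrow> weyl_m a b z) ?F"
      using z(1) z_nu unfolding off[symmetric] \<nu>_def
      by (intro tendsto_within_subset[OF T.tendsto_weyl_m subset_UNIV])
    moreover have "(w \<longlongrightarrow> w z) ?F"
      using boundary_values_continuous[OF side, of s w "- \<nu>"] w nu unfolding zn
      by (simp add: is_w_branch_def abs_less_iff)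
    ultimately have "(chi1 a b w \<longlongrightarrow> chi1 a b w z) ?F"
      unfolding chi1 using w_nz[OF z(1)] by (intro tendsto_divide)
    moreover have "\<forall>\<^sub>F y in ?F. chi1 a b w y = rhs y"
    proof -
      \<comment> \<open>Away from both \<nu> and -\<nu> the factorization keeps \<open>den\<close>
        nonzero, so \<open>rhs\<close> agrees with the continuous \<open>chi1\<close> near
        z.\<close>
      have "\<forall>\<^sub>F y in at z. y \<noteq> of_real \<nu>" "\<forall>\<^sub>F y in at z. y \<noteq> z"
        by (rule eventually_neq_at_within)+
      with open_off[OF z(1)] have "\<forall>\<^sub>F y in at z. chi1 a b w y = rhs y"
      proof eventually_elim
        case (elim y)
        then have "y + \<nu> \<noteq> 0" "y - \<nu> \<noteq> 0" unfolding zn by (auto simp: eq_neg_iff_add_eq_0)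
        then have "a 0 * w2_fun a b y + a 1 \<noteq> 0"
          using fact[OF elim(1)] w2(1)[OF elim(1)] unfolding \<nu>_def by auto
        then show ?case using elim P.a_nz[of 0] by (intro main) (auto simp: den)
      qed
      then show ?thesis by (rule filter_leD[OF at_le, rotated]) simp
    qed
    ultimately have lim: "(rhs \<longlongrightarrow> chi1 a b w z) ?F" by (rule Lim_transform_eventually)
    show ?thesis by (intro conjI zn eps lim)
  qed
  show ?thesis
  proof (intro allI impI)
    fix z assume "z \<notin> bands \<and> (eps a b = 1 \<longrightarrow> z \<noteq> of_real \<nu>)"
    then show "(den z \<noteq> 0 \<longrightarrow> chi1 a b w z = rhs z) \<and>
        (den z = 0 \<longrightarrow> z = - of_real \<nu> \<and> eps a b = 1 \<and>
          (rhs \<longlongrightarrow> chi1 a b w z) (at z within {\<zeta>. 0 \<le> \<sigma> * Im \<zeta>}))"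
      by (intro conjI[OF impI impI] main degenerate) auto
  qed
qed

end
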